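(* Let $(M,D,g)$ be a Hesse-Einstein manifold, i.e. a Hessian manifold with $\beta=\lambda g$ for some $\lambda\in\mathbb{R}$. Then the dual space $(M,D',g)$ is a Hesse soliton with vector field $-2\alpha^\sharp$, that is, it satisfies $$\beta'-\frac{1}{2}\mathcal{L}_{(-2\alpha^\sharp)}g=\lambda g.$$
   Context: All manifolds are smooth. A connection $D$ on $TM$ is flat if it is torsion free and its curvature tensor vanishes. A Hessian manifold $(M,D,g)$ is a manifold $M$ with a flat connection $D$ and a Riemannian metric $g$ that is locally of the form $g=Dd\varphi$ for a smooth function $\varphi$, i.e. $g_{ij}=\partial_i\partial_j\varphi$ in affine coordinates (local coordinates with $D_{\partial_i}\partial_j=0$). $\nabla$ denotes the Levi-Civita connection of $g$. With $v_g$ the (local) volume form of $g$, the first Koszul form $\alpha$ and second Koszul form $\beta$ are defined by $D_Xv_g=\alpha(X)v_g$ and $\beta=D\alpha$. The dual connection is $D'=2\nabla-D$; it is again flat, and $(D',g)$ is again a Hessian structure (the dual Hessian structure). Its Koszul forms are $\alpha'$ and $\beta'$, given by $D'_Xv_g=\alpha'(X)v_g$ and $\beta'=D'\alpha'$. A Hesse soliton is a Hessian manifold $(M,D,g)$ for which there exist a vector field $X$ and $\lambda\in\mathbb{R}$ with $\beta-\frac12\mathcal{L}_Xg=\lambda g$, where $\mathcal{L}_X$ is the Lie derivative. The vector field $\alpha^\sharp$ is defined by $g(\alpha^\sharp,Y)=\alpha(Y)$ for every vector field $Y$. *)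

theory Defs
  imports "HOL-Analysis.Analysis"
begin

section \<open>Smooth manifolds\<close>

primrec Ck_on :: "nat \<Rightarrow> ('e::euclidean_space \<Rightarrow> 'f::real_normed_vector) \<Rightarrow> 'e set \<Rightarrow> bool" where
  "Ck_on 0 f S \<longleftrightarrow> continuous_on S f"
| "Ck_on (Suc k) f S \<longleftrightarrow> (\<forall>x\<in>S. f differentiable (at x)) \<and>
      (\<forall>v. Ck_on k (\<lambda>x. frechet_derivative f (at x) v) S)"

text \<open>Only used for open \<open>S\<close>.\<close>

definition smooth_on :: "('e::euclidean_space \<Rightarrow> 'f::real_normed_vector) \<Rightarrow> 'e set \<Rightarrow> bool" where
  "smooth_on f S \<longleftrightarrow> (\<forall>k. Ck_on k f S)"

text \<open>A chart is a pair of its domain and its coordinate map; the values of the coordinate map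
  outside the domain are irrelevant.\<close>

record ('a, 'n) mfd =
  mtop :: "'a topology"
  atlas :: "('a set \<times> ('a \<Rightarrow> real^'n)) set"

definition chart_inv :: "'a set \<times> ('a \<Rightarrow> real^'n) \<Rightarrow> real^'n \<Rightarrow> 'a" where
  "chart_inv c = inv_into (fst c) (snd c)"

definition is_chart :: "'a topology \<Rightarrow> 'a set \<times> ('a \<Rightarrow> real^'n) \<Rightarrow> bool" where
  "is_chart T c \<longleftrightarrow> openin T (fst c) \<and> open (snd c ` fst c) \<and>
     homeomorphic_map (subtopology T (fst c)) (top_of_set (snd c ` fst c)) (snd c)"

definition compatible :: "'a set \<times> ('a \<Rightarrow> real^'n) \<Rightarrow> 'a set \<times> ('a \<Rightarrow> real^'n) \<Rightarrow> bool" where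
  "compatible c d \<longleftrightarrow>
     smooth_on (snd d \<circ> chart_inv c) (snd c ` (fst c \<inter> fst d)) \<and>
     smooth_on (snd c \<circ> chart_inv d) (snd d ` (fst c \<inter> fst d))"

text \<open>The atlas is required to be maximal, so \<open>atlas M\<close> consists of all charts of the smooth
  structure.\<close>

definition smooth_manifold :: "('a, 'n::finite) mfd \<Rightarrow> bool" where
  "smooth_manifold M \<longleftrightarrow>
     Hausdorff_space (mtop M) \<and> second_countable (mtop M) \<and>
     (\<forall>c\<in>atlas M. is_chart (mtop M) c) \<and>
     (\<Union>c\<in>atlas M. fst c) = topspace (mtop M) \<and>
     (\<forall>c\<in>atlas M. \<forall>d\<in>atlas M. compatible c d) \<and>
     (\<forall>c. is_chart (mtop M) c \<and> (\<forall>d\<in>atlas M. compatible c d) \<longrightarrow> c \<in> atlas M)"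

definition smooth_fun :: "('a, 'n::finite) mfd \<Rightarrow> 'a set \<Rightarrow> ('a \<Rightarrow> real) \<Rightarrow> bool" where
  "smooth_fun M U f \<longleftrightarrow> openin (mtop M) U \<and>
     (\<forall>c\<in>atlas M. smooth_on (f \<circ> chart_inv c) (snd c ` (fst c \<inter> U)))"

definition smooth_near :: "('a, 'n::finite) mfd \<Rightarrow> 'a \<Rightarrow> ('a \<Rightarrow> real) \<Rightarrow> bool" where
  "smooth_near M p f \<longleftrightarrow> (\<exists>U. p \<in> U \<and> smooth_fun M U f)"


section \<open>Tangent vectors, vector fields and tensors\<close>

text \<open>A tangent vector at \<open>p\<close> is a directional derivative acting on the functions that are smooth
  near \<open>p\<close>; on all other functions it takes the value 0, so that a tangent vector is determined
  by its action on smooth functions.\<close>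

type_synonym 'a tvec = "('a \<Rightarrow> real) \<Rightarrow> real"
type_synonym 'a vfield = "'a \<Rightarrow> 'a tvec"

definition dir_deriv ::
    "('a, 'n::finite) mfd \<Rightarrow> 'a set \<times> ('a \<Rightarrow> real^'n) \<Rightarrow> 'a \<Rightarrow> real^'n \<Rightarrow> 'a tvec" where
  "dir_deriv M c p w = (\<lambda>f. if smooth_near M p f
     then frechet_derivative (f \<circ> chart_inv c) (at (snd c p)) w else 0)"

definition tangent_space :: "('a, 'n::finite) mfd \<Rightarrow> 'a \<Rightarrow> 'a tvec set" where
  "tangent_space M p = {dir_deriv M c p w |c w. c \<in> atlas M \<and> p \<in> fst c}"

definition coord_field ::
    "('a, 'n::finite) mfd \<Rightarrow> 'a set \<times> ('a \<Rightarrow> real^'n) \<Rightarrow> 'n \<Rightarrow> 'a vfield" where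
  "coord_field M c i = (\<lambda>p. dir_deriv M c p (axis i 1))"

text \<open>The function \<open>X f\<close> is \<open>\<lambda>p. X p f\<close>. Being a smooth vector field only restricts the values of
  \<open>X\<close> on the open set \<open>U\<close>.\<close>

definition vector_field :: "('a, 'n::finite) mfd \<Rightarrow> 'a set \<Rightarrow> 'a vfield \<Rightarrow> bool" where
  "vector_field M U X \<longleftrightarrow> openin (mtop M) U \<and>
     (\<forall>p\<in>U. X p \<in> tangent_space M p) \<and>
     (\<forall>V f. V \<subseteq> U \<and> smooth_fun M V f \<longrightarrow> smooth_fun M V (\<lambda>p. X p f))"

definition bracket :: "('a, 'n::finite) mfd \<Rightarrow> 'a vfield \<Rightarrow> 'a vfield \<Rightarrow> 'a vfield" where
  "bracket M X Y = (\<lambda>p f. if smooth_near M p f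
     then X p (\<lambda>q. Y q f) - Y p (\<lambda>q. X q f) else 0)"

definition linear_on_tangent ::
    "('a, 'n::finite) mfd \<Rightarrow> 'a \<Rightarrow> ('a tvec \<Rightarrow> real) \<Rightarrow> bool" where
  "linear_on_tangent M p l \<longleftrightarrow>
     (\<forall>v\<in>tangent_space M p. \<forall>w\<in>tangent_space M p. \<forall>a b.
        l (\<lambda>f. a * v f + b * w f) = a * l v + b * l w)"

definition one_form :: "('a, 'n::finite) mfd \<Rightarrow> ('a \<Rightarrow> 'a tvec \<Rightarrow> real) \<Rightarrow> bool" where
  "one_form M \<omega> \<longleftrightarrow>
     (\<forall>p\<in>topspace (mtop M). linear_on_tangent M p (\<omega> p)) \<and>
     (\<forall>U X. vector_field M U X \<longrightarrow> smooth_fun M U (\<lambda>p. \<omega> p (X p)))"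

definition riemannian_metric ::
    "('a, 'n::finite) mfd \<Rightarrow> ('a \<Rightarrow> 'a tvec \<Rightarrow> 'a tvec \<Rightarrow> real) \<Rightarrow> bool" where
  "riemannian_metric M g \<longleftrightarrow>
     (\<forall>p\<in>topspace (mtop M). \<forall>v\<in>tangent_space M p.
        linear_on_tangent M p (g p v) \<and>
        (\<forall>w\<in>tangent_space M p. g p v w = g p w v) \<and>
        (v \<noteq> (\<lambda>_. 0) \<longrightarrow> g p v v > 0)) \<and>
     (\<forall>U X Y. vector_field M U X \<and> vector_field M U Y \<longrightarrow>
        smooth_fun M U (\<lambda>p. g p (X p) (Y p)))"

definition sharp ::
    "('a, 'n::finite) mfd \<Rightarrow> ('a \<Rightarrow> 'a tvec \<Rightarrow> 'a tvec \<Rightarrow> real) \<Rightarrow> ('a \<Rightarrow> 'a tvec \<Rightarrow> real) \<Rightarrow> 'a vfield"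
  where
  "sharp M g \<omega> p = (THE w. w \<in> tangent_space M p \<and> (\<forall>v\<in>tangent_space M p. g p w v = \<omega> p v))"

definition lie_metric ::
    "('a, 'n::finite) mfd \<Rightarrow> 'a vfield \<Rightarrow> ('a \<Rightarrow> 'a tvec \<Rightarrow> 'a tvec \<Rightarrow> real) \<Rightarrow>
     'a vfield \<Rightarrow> 'a vfield \<Rightarrow> 'a \<Rightarrow> real" where
  "lie_metric M X g Y Z p = X p (\<lambda>q. g q (Y q) (Z q))
     - g p (bracket M X Y p) (Z p) - g p (Y p) (bracket M X Z p)"


section \<open>Connections\<close>

text \<open>A connection acts on vector fields over arbitrary open sets, compatibly with restriction:
  on an open set \<open>U\<close> the field \<open>D X Y\<close> depends only on \<open>X\<close> and \<open>Y\<close> on \<open>U\<close>. Values of \<open>D\<close> at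
  arguments that are not smooth near a point carry no information.\<close>

definition connection :: "('a, 'n::finite) mfd \<Rightarrow> ('a vfield \<Rightarrow> 'a vfield \<Rightarrow> 'a vfield) \<Rightarrow> bool" where
  "connection M D \<longleftrightarrow>
     (\<forall>U X Y. vector_field M U X \<and> vector_field M U Y \<longrightarrow>
        vector_field M U (D X Y)) \<and>
     (\<forall>U X X' Y Y'. vector_field M U X \<and> vector_field M U X' \<and>
        vector_field M U Y \<and> vector_field M U Y' \<and>
        (\<forall>p\<in>U. X p = X' p \<and> Y p = Y' p) \<longrightarrow> (\<forall>p\<in>U. D X Y p = D X' Y' p)) \<and>
     (\<forall>U a X X' Y. smooth_fun M U a \<and> vector_field M U X \<and> vector_field M U X' \<and>
        vector_field M U Y \<longrightarrow>
        (\<forall>p\<in>U. D (\<lambda>q f. a q * X q f + X' q f) Y p = (\<lambda>f. a p * D X Y p f + D X' Y p f))) \<and>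
     (\<forall>U a X Y Y'. smooth_fun M U a \<and> vector_field M U X \<and> vector_field M U Y \<and>
        vector_field M U Y' \<longrightarrow>
        (\<forall>p\<in>U. D X (\<lambda>q f. a q * Y q f + Y' q f) p =
           (\<lambda>f. X p a * Y p f + a p * D X Y p f + D X Y' p f)))"

definition torsion_free ::
    "('a, 'n::finite) mfd \<Rightarrow> ('a vfield \<Rightarrow> 'a vfield \<Rightarrow> 'a vfield) \<Rightarrow> bool" where
  "torsion_free M D \<longleftrightarrow>
     (\<forall>U X Y. vector_field M U X \<and> vector_field M U Y \<longrightarrow>
        (\<forall>p\<in>U. \<forall>f. D X Y p f - D Y X p f - bracket M X Y p f = 0))"

definition curvature_zero ::
    "('a, 'n::finite) mfd \<Rightarrow> ('a vfield \<Rightarrow> 'a vfield \<Rightarrow> 'a vfield) \<Rightarrow> bool" where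
  "curvature_zero M D \<longleftrightarrow>
     (\<forall>U X Y Z. vector_field M U X \<and> vector_field M U Y \<and> vector_field M U Z \<longrightarrow>
        (\<forall>p\<in>U. \<forall>f. D X (D Y Z) p f - D Y (D X Z) p f - D (bracket M X Y) Z p f = 0))"

definition flat_connection ::
    "('a, 'n::finite) mfd \<Rightarrow> ('a vfield \<Rightarrow> 'a vfield \<Rightarrow> 'a vfield) \<Rightarrow> bool" where
  "flat_connection M D \<longleftrightarrow> connection M D \<and> torsion_free M D \<and> curvature_zero M D"

definition levi_civita ::
    "('a, 'n::finite) mfd \<Rightarrow> ('a \<Rightarrow> 'a tvec \<Rightarrow> 'a tvec \<Rightarrow> real) \<Rightarrow>
     ('a vfield \<Rightarrow> 'a vfield \<Rightarrow> 'a vfield) \<Rightarrow> bool" where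
  "levi_civita M g N \<longleftrightarrow> connection M N \<and> torsion_free M N \<and>
     (\<forall>U X Y Z. vector_field M U X \<and> vector_field M U Y \<and> vector_field M U Z \<longrightarrow>
        (\<forall>p\<in>U. X p (\<lambda>q. g q (Y q) (Z q)) = g p (N X Y p) (Z p) + g p (Y p) (N X Z p)))"

definition dual_connection ::
    "('a vfield \<Rightarrow> 'a vfield \<Rightarrow> 'a vfield) \<Rightarrow> ('a vfield \<Rightarrow> 'a vfield \<Rightarrow> 'a vfield) \<Rightarrow>
     'a vfield \<Rightarrow> 'a vfield \<Rightarrow> 'a vfield" where
  "dual_connection N D X Y = (\<lambda>p f. 2 * N X Y p f - D X Y p f)"

text \<open>The value \<open>(D\<^sub>X \<omega>)(Y)\<close>.\<close>

definition cov_one_form ::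
    "('a vfield \<Rightarrow> 'a vfield \<Rightarrow> 'a vfield) \<Rightarrow> ('a \<Rightarrow> 'a tvec \<Rightarrow> real) \<Rightarrow>
     'a vfield \<Rightarrow> 'a vfield \<Rightarrow> 'a \<Rightarrow> real" where
  "cov_one_form D \<omega> X Y p = X p (\<lambda>q. \<omega> q (Y q)) - \<omega> p (D X Y p)"

text \<open>The value \<open>(D\<^sub>X v)(E\<^sub>1, \<dots>, E\<^sub>n)\<close> for an n-form \<open>v\<close>, with arguments indexed by the type \<open>'n\<close>.\<close>

definition cov_top_form ::
    "('a vfield \<Rightarrow> 'a vfield \<Rightarrow> 'a vfield) \<Rightarrow> ('a \<Rightarrow> ('n::finite \<Rightarrow> 'a tvec) \<Rightarrow> real) \<Rightarrow>
     'a vfield \<Rightarrow> ('n \<Rightarrow> 'a vfield) \<Rightarrow> 'a \<Rightarrow> real" where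
  "cov_top_form D v X E p = X p (\<lambda>q. v q (\<lambda>i. E i q))
     - (\<Sum>i\<in>UNIV. v p ((\<lambda>j. E j p)(i := D X (E i) p)))"


section \<open>Hessian manifolds and Koszul forms\<close>

definition affine_chart ::
    "('a, 'n::finite) mfd \<Rightarrow> ('a vfield \<Rightarrow> 'a vfield \<Rightarrow> 'a vfield) \<Rightarrow>
     'a set \<times> ('a \<Rightarrow> real^'n) \<Rightarrow> bool" where
  "affine_chart M D c \<longleftrightarrow> c \<in> atlas M \<and>
     (\<forall>p\<in>fst c. \<forall>i j. D (coord_field M c i) (coord_field M c j) p = (\<lambda>_. 0))"

text \<open>Locally \<open>g = D d\<phi>\<close>, expressed in affine coordinates as \<open>g\<^sub>i\<^sub>j = \<partial>\<^sub>i \<partial>\<^sub>j \<phi>\<close>.\<close>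

definition hessian_manifold ::
    "('a, 'n::finite) mfd \<Rightarrow> ('a vfield \<Rightarrow> 'a vfield \<Rightarrow> 'a vfield) \<Rightarrow>
     ('a \<Rightarrow> 'a tvec \<Rightarrow> 'a tvec \<Rightarrow> real) \<Rightarrow> bool" where
  "hessian_manifold M D g \<longleftrightarrow>
     smooth_manifold M \<and> flat_connection M D \<and> riemannian_metric M g \<and>
     (\<forall>p\<in>topspace (mtop M). \<exists>c \<phi>. affine_chart M D c \<and> p \<in> fst c \<and> smooth_fun M (fst c) \<phi> \<and>
        (\<forall>q\<in>fst c. \<forall>i j. g q (coord_field M c i q) (coord_field M c j q) =
           coord_field M c i q (\<lambda>r. coord_field M c j r \<phi>)))"

text \<open>The local volume form \<open>\<surd>det(g\<^sub>i\<^sub>j) dx\<^sup>1 \<and> \<dots> \<and> dx\<^sup>n\<close> in the coordinates of the chart \<open>c\<close>.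
  It depends on \<open>c\<close> only up to sign.\<close>

definition volume_form ::
    "('a, 'n::finite) mfd \<Rightarrow> ('a \<Rightarrow> 'a tvec \<Rightarrow> 'a tvec \<Rightarrow> real) \<Rightarrow>
     'a set \<times> ('a \<Rightarrow> real^'n) \<Rightarrow> 'a \<Rightarrow> ('n \<Rightarrow> 'a tvec) \<Rightarrow> real" where
  "volume_form M g c p v =
     sqrt (det (\<chi> i j. g p (coord_field M c i p) (coord_field M c j p))) *
     det (\<chi> i j. v i (\<lambda>q. snd c q $ j))"

definition first_koszul_form ::
    "('a, 'n::finite) mfd \<Rightarrow> ('a vfield \<Rightarrow> 'a vfield \<Rightarrow> 'a vfield) \<Rightarrow>
     ('a \<Rightarrow> 'a tvec \<Rightarrow> 'a tvec \<Rightarrow> real) \<Rightarrow> ('a \<Rightarrow> 'a tvec \<Rightarrow> real) \<Rightarrow> bool" where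
  "first_koszul_form M D g \<alpha> \<longleftrightarrow> one_form M \<alpha> \<and>
     (\<forall>c\<in>atlas M. \<forall>U X E. U \<subseteq> fst c \<and> vector_field M U X \<and> (\<forall>i. vector_field M U (E i)) \<longrightarrow>
        (\<forall>p\<in>U. cov_top_form D (volume_form M g c) X E p =
           \<alpha> p (X p) * volume_form M g c p (\<lambda>i. E i p)))"

text \<open>The second Koszul form is \<open>\<beta> = D \<alpha>\<close>, i.e. \<open>cov_one_form D \<alpha>\<close>. The conditions defining
  \<open>\<alpha>\<close> determine it uniquely on the tangent spaces of \<open>M\<close>.\<close>

definition hesse_einstein ::
    "('a, 'n::finite) mfd \<Rightarrow> ('a vfield \<Rightarrow> 'a vfield \<Rightarrow> 'a vfield) \<Rightarrow>
     ('a \<Rightarrow> 'a tvec \<Rightarrow> 'a tvec \<Rightarrow> real) \<Rightarrow> real \<Rightarrow> bool" where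
  "hesse_einstein M D g lam \<longleftrightarrow> hessian_manifold M D g \<and>
     (\<exists>\<alpha>. first_koszul_form M D g \<alpha> \<and>
        (\<forall>U Y Z. vector_field M U Y \<and> vector_field M U Z \<longrightarrow>
           (\<forall>p\<in>U. cov_one_form D \<alpha> Y Z p = lam * g p (Y p) (Z p))))"

definition hesse_soliton_with ::
    "('a, 'n::finite) mfd \<Rightarrow> ('a vfield \<Rightarrow> 'a vfield \<Rightarrow> 'a vfield) \<Rightarrow>
     ('a \<Rightarrow> 'a tvec \<Rightarrow> 'a tvec \<Rightarrow> real) \<Rightarrow> 'a vfield \<Rightarrow> real \<Rightarrow> bool" where
  "hesse_soliton_with M D g X lam \<longleftrightarrow> hessian_manifold M D g \<and>
     vector_field M (topspace (mtop M)) X \<and>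
     (\<exists>\<alpha>. first_koszul_form M D g \<alpha> \<and>
        (\<forall>U Y Z. vector_field M U Y \<and> vector_field M U Z \<longrightarrow>
           (\<forall>p\<in>U. cov_one_form D \<alpha> Y Z p - 1/2 * lie_metric M X g Y Z p = lam * g p (Y p) (Z p))))"

end

theory Submission
  imports Defs
begin

text \<open>
  In an affine chart with potential \<open>\<phi>\<close>, Koszul's formula gives
  \<open>g (D' X Y) \<partial>\<^sub>k = X (g Y \<partial>\<^sub>k)\<close>. Hence the functions
  \<open>y\<^sub>k = \<partial>\<^sub>k \<phi>\<close>, whose Jacobian is the Gram matrix of \<open>g\<close>, are affine coordinates for
  \<open>D'\<close>, and the Legendre transform \<open>(\<Sum>k. x\<^sub>k y\<^sub>k) - \<phi>\<close> is a potential for \<open>g\<close> in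
  them. So \<open>D'\<close> is flat and \<open>(D', g)\<close> is Hessian.

  The volume form is parallel for the Levi-Civita connection \<open>N\<close>, so \<open>D' = 2 N - D\<close> has first
  Koszul form \<open>- \<alpha>\<close>. The Lie derivative of \<open>g\<close> along \<open>\<alpha>\<^sup>\<sharp>\<close> is the symmetrization of \<open>N \<alpha>\<close>,
  so
  \<open>\<beta>' Y Z + (L g) Y Z = \<alpha> (N Y Z - N Z Y) - \<alpha> (D Y Z) + Z (\<alpha> Y) = Z (\<alpha> Y) - \<alpha> (D Z Y) = \<beta> Z Y\<close>,
  where the middle step uses that \<open>N\<close> and \<open>D\<close> are torsion free.
\<close>

section \<open>Functions of class \<open>C\<^sup>k\<close>\<close>

text \<open>\<open>hessian_manifold\<close> asks for affine charts that belong to the maximal atlas.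
  The functions y_k therefore help only after a smooth inverse function theorem has turned them into
  a chart compatible with all others; the C^k calculus serves mainly this purpose. Vectors are
  operators on functions, so an identity between vectors is tested on n functions: chart
  coordinates, or the y_k, which separate vectors because pairing v with the k-th coordinate field
  gives v(y_k) and g is nondegenerate. On y_k the vector D'_X Y takes the value X(Y y_k), so
  vanishing curvature becomes the definition of the bracket. The volume form is parallel by Jacobi's
  formula for \<open>det\<close>, applied once to the Gram matrix and once to the components of the
  frame: the two traces of the connection matrix cancel. The factor -2 makes the Lie term equal to
  the full symmetrization of N \<alpha>; its summand Y(\<alpha> Z) - \<alpha>(N_Y Z) reduces the
  part -Y(\<alpha> Z) + 2 \<alpha>(N_Y Z) of \<beta>' to \<alpha>(N_Y Z).\<close>

lemma Ck_on_cong: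
  assumes "open S" "\<And>x. x \<in> S \<Longrightarrow> f x = g x" "Ck_on k f S"
  shows "Ck_on k g S"
  using assms(2,3)
proof (induction k arbitrary: f g)
  case 0
  then show ?case using continuous_on_cong by fastforce
next
  case (Suc k)
  have d: "(g has_derivative frechet_derivative f (at x)) (at x)" if "x \<in> S" for x
    using Suc.prems that assms(1)
    by (auto simp: frechet_derivative_works intro: has_derivative_transform_within_open)
  then have eq: "frechet_derivative g (at x) = frechet_derivative f (at x)" if "x \<in> S" for x
    using frechet_derivative_at that by metis
  show ?case
    using d Suc.prems(2) eq by (auto simp: differentiable_def intro: Suc.IH)
qed

text \<open>Uniqueness of the derivative allows any explicit formula for it in place of
  \<open>frechet_derivative\<close>. The closure properties below all enter the next order through
  this rule.\<close>

lemma Ck_on_SucI: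
  assumes "open S" "\<And>x. x \<in> S \<Longrightarrow> (f has_derivative f' x) (at x)"
    "\<And>v. Ck_on k (\<lambda>x. f' x v) S"
  shows "Ck_on (Suc k) f S"
proof -
  have "Ck_on k (\<lambda>x. frechet_derivative f (at x) v) S" for v
    by (rule Ck_on_cong[OF assms(1) _ assms(3)[of v]])
      (use assms(2) frechet_derivative_at in metis)
  then show ?thesis
    using assms(2) by (auto simp: differentiable_def)
qed

lemma Ck_on_SucD:
  assumes "Ck_on (Suc k) f S" "x \<in> S"
  shows "(f has_derivative frechet_derivative f (at x)) (at x)"
  using assms by (auto simp: frechet_derivative_works)

lemma Ck_on_Suc_frechet: "Ck_on (Suc k) f S \<Longrightarrow> Ck_on k (\<lambda>x. frechet_derivative f (at x) v) S"
  by simp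

lemma Ck_on_Suc_mono: "Ck_on (Suc k) f S \<Longrightarrow> Ck_on k f S"
proof (induction k arbitrary: f)
  case 0
  then show ?case
    by (auto simp: continuous_on_eq_continuous_within
        intro!: differentiable_imp_continuous_within dest: differentiable_at_withinI)
qed (simp add: Ball_def)

lemma Ck_on_subset: "Ck_on k f S \<Longrightarrow> T \<subseteq> S \<Longrightarrow> Ck_on k f T"
  by (induction k arbitrary: f) (auto intro: continuous_on_subset)

lemma Ck_on_local:
  assumes "\<And>x. x \<in> S \<Longrightarrow> \<exists>T. open T \<and> x \<in> T \<and> Ck_on k f T"
  shows "Ck_on k f S"
  using assms
proof (induction k arbitrary: f)
  case 0
  then have "isCont f x" if "x \<in> S" for x
    using that continuous_on_eq_continuous_at by (metis Ck_on.simps(1))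
  then show ?case by (simp add: continuous_at_imp_continuous_on)
next
  case (Suc k)
  then show ?case by simp meson
qed

lemma Ck_on_const: "Ck_on k (\<lambda>x. c) S"
  by (induction k arbitrary: c) auto

lemma Ck_on_linear_compose:
  assumes "open S" "bounded_linear L" "Ck_on k f S"
  shows "Ck_on k (\<lambda>x. L (f x)) S"
  using assms(3)
proof (induction k arbitrary: f)
  case 0
  then show ?case using assms(2) bounded_linear.continuous_on by auto
next
  case (Suc k)
  show ?case
    by (rule Ck_on_SucI[OF assms(1)
          bounded_linear.has_derivative[OF assms(2) Ck_on_SucD[OF Suc.prems]]])
      (use Suc in auto)
qed

lemma Ck_on_add:
  assumes "open S" "Ck_on k f S" "Ck_on k g S"
  shows "Ck_on k (\<lambda>x. f x + g x) S"
  using assms(2,3)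
proof (induction k arbitrary: f g)
  case 0
  then show ?case by (auto intro: continuous_on_add)
next
  case (Suc k)
  show ?case
    by (rule Ck_on_SucI[OF assms(1)
          has_derivative_add[OF Ck_on_SucD[OF Suc.prems(1)] Ck_on_SucD[OF Suc.prems(2)]]])
      (use Suc in auto)
qed

lemma Ck_on_scaleR:
  assumes "open S" "Ck_on k a S" "Ck_on k f S"
  shows "Ck_on k (\<lambda>x. a x *\<^sub>R f x) S"
  using assms(2,3)
proof (induction k arbitrary: a f)
  case 0
  then show ?case by (auto intro: continuous_on_scaleR)
next
  case (Suc k)
  \<comment> \<open>The product rule pairs each factor with the derivative of the other, so the
    induction hypothesis needs the factors themselves at order \<open>k\<close> as well.\<close>
  note f = Ck_on_Suc_mono[OF Suc.prems(1)] Ck_on_Suc_mono[OF Suc.prems(2)]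
    and f' = Ck_on_Suc_frechet[OF Suc.prems(1)] Ck_on_Suc_frechet[OF Suc.prems(2)]
  show ?case
    by (rule Ck_on_SucI[OF assms(1)
          has_derivative_scaleR[OF Ck_on_SucD[OF Suc.prems(1)] Ck_on_SucD[OF Suc.prems(2)]]])
      (simp_all add: Ck_on_add[OF assms(1) Suc.IH[OF f(1) f'(2)] Suc.IH[OF f'(1) f(2)]])
qed

lemma Ck_on_mult:
  fixes a b :: "'e::euclidean_space \<Rightarrow> real"
  assumes "open S" "Ck_on k a S" "Ck_on k b S"
  shows "Ck_on k (\<lambda>x. a x * b x) S"
  using Ck_on_scaleR[OF assms] by simp

lemma Ck_on_sum:
  assumes "open S" "\<And>i. i \<in> I \<Longrightarrow> Ck_on k (f i) S"
  shows "Ck_on k (\<lambda>x. \<Sum>i\<in>I. f i x) S"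
  using assms(2)
  by (induction I rule: infinite_finite_induct) (auto intro!: Ck_on_const Ck_on_add assms(1))

lemma Ck_on_prod:
  fixes f :: "'i \<Rightarrow> 'e::euclidean_space \<Rightarrow> real"
  assumes "open S" "\<And>i. i \<in> I \<Longrightarrow> Ck_on k (f i) S"
  shows "Ck_on k (\<lambda>x. \<Prod>i\<in>I. f i x) S"
  using assms(2)
  by (induction I rule: infinite_finite_induct) (auto intro!: Ck_on_const Ck_on_mult assms(1))

lemma Ck_on_compose:
  fixes f :: "'e::euclidean_space \<Rightarrow> 'f::euclidean_space" and g :: "'f \<Rightarrow> 'g::real_normed_vector"
  assumes "open S" "open T" "f ` S \<subseteq> T" "Ck_on k f S" "Ck_on k g T"
  shows "Ck_on k (g \<circ> f) S"
  using assms(4,5)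
proof (induction k arbitrary: g)
  case 0
  then have "continuous_on S f" "continuous_on (f ` S) g"
    using assms(3) by (auto intro: continuous_on_subset)
  then show ?case unfolding Ck_on.simps by (rule continuous_on_compose)
next
  case (Suc k)
  have fx: "f x \<in> T" if "x \<in> S" for x using that assms(3) by auto
  have lin: "linear (frechet_derivative g (at (f x)))" if "x \<in> S" for x
    using Suc.prems(2) fx[OF that] by (auto intro: linear_frechet_derivative)
  \<comment> \<open>The derivative of \<open>g\<close> at \<open>f x\<close> is expanded in the
    basis. Each summand then has a fixed direction \<open>b\<close>, and the induction hypothesis
    applies to the derivative of \<open>g\<close> along \<open>b\<close> composed with
    \<open>f\<close>.\<close>
  let ?d = "\<lambda>x v. \<Sum>b\<in>Basis. (frechet_derivative f (at x) v \<bullet> b) *\<^sub>R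
              (((\<lambda>y. frechet_derivative g (at y) b) \<circ> f) x)"
  have "((g \<circ> f) has_derivative ?d x) (at x)" if x: "x \<in> S" for x
  proof -
    note has = diff_chain_at[OF Ck_on_SucD[OF Suc.prems(1) x] Ck_on_SucD[OF Suc.prems(2) fx[OF x]]]
    have "frechet_derivative g (at (f x)) w
        = (\<Sum>b\<in>Basis. (w \<bullet> b) *\<^sub>R frechet_derivative g (at (f x)) b)" for w
    proof -
      have "frechet_derivative g (at (f x)) (\<Sum>b\<in>Basis. (w \<bullet> b) *\<^sub>R b)
          = (\<Sum>b\<in>Basis. (w \<bullet> b) *\<^sub>R frechet_derivative g (at (f x)) b)"
        by (simp only: linear_sum[OF lin[OF x]] linear_scale[OF lin[OF x]])
      then show ?thesis unfolding euclidean_representation .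
    qed
    then have "frechet_derivative g (at (f x)) \<circ> frechet_derivative f (at x) = ?d x"
      unfolding o_def by (rule ext)
    with has show ?thesis by simp
  qed
  then show ?case
  proof (rule Ck_on_SucI[OF assms(1)])
    fix v
    have "Ck_on k (\<lambda>x. frechet_derivative f (at x) v \<bullet> b) S" for b
      by (rule Ck_on_linear_compose[OF assms(1) bounded_linear_inner_left
            Ck_on_Suc_frechet[OF Suc.prems(1)]])
    moreover have "Ck_on k ((\<lambda>y. frechet_derivative g (at y) b) \<circ> f) S" for b
      by (rule Suc.IH[OF Ck_on_Suc_mono[OF Suc.prems(1)] Ck_on_Suc_frechet[OF Suc.prems(2)]])
    ultimately show "Ck_on k (\<lambda>x. ?d x v) S"
      by (intro Ck_on_sum[OF assms(1)] Ck_on_scaleR[OF assms(1)])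
  qed
qed

text \<open>Bootstrapping: the derivative is a polynomial in the function itself, so order
  \<open>k\<close> yields order \<open>k + 1\<close>. For \<open>sqrt\<close> the derivative is half
  of \<open>inverse\<close> after \<open>sqrt\<close>, and the same argument works.\<close>

lemma Ck_on_inverse: "Ck_on k (inverse :: real \<Rightarrow> real) (- {0})"
proof (induction k)
  case 0
  then show ?case by (auto intro!: continuous_intros)
next
  case (Suc k)
  have "Ck_on k (\<lambda>x. - (inverse x * h * inverse x)) (- {0})" for h :: real
  proof -
    have "Ck_on k (\<lambda>x. (- h) * (inverse x * inverse x)) (- {0})"
      by (intro Ck_on_mult Ck_on_const Suc open_delete open_UNIV | simp add: Compl_eq_Diff_UNIV)+
    then show ?thesis by (simp add: algebra_simps)
  qed
  then show ?case
    by (intro Ck_on_SucI[OF _ has_derivative_inverse']) (auto)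
qed

lemma Ck_on_sqrt: "Ck_on k sqrt {0<..}"
proof (induction k)
  case 0
  then show ?case by (auto intro!: continuous_intros)
next
  case (Suc k)
  have 1: "(sqrt has_derivative (\<lambda>h. h * (inverse (sqrt x) / 2))) (at x)" if "x \<in> {0<..}" for x
  proof -
    have "(\<lambda>h. h * (inverse (sqrt x) / 2)) = (*) (inverse (sqrt x) / 2)" by (simp add: fun_eq_iff)
    then show ?thesis using DERIV_real_sqrt[of x] that by (simp add: has_field_derivative_def)
  qed
  have "Ck_on k (inverse \<circ> sqrt) {0<..}"
    by (rule Ck_on_compose[OF _ _ _ Suc Ck_on_inverse]) auto
  then have "Ck_on k (\<lambda>x. (h / 2) * (inverse \<circ> sqrt) x) {0<..}" for h
    by (intro Ck_on_mult[OF _ Ck_on_const]) (simp_all add: o_def)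
  then show ?case
    by (intro Ck_on_SucI[OF _ 1]) (auto simp: algebra_simps)
qed

lemma Ck_on_vec:
  fixes f :: "'e::euclidean_space \<Rightarrow> real^'n"
  assumes "open S" "\<And>i. Ck_on k (\<lambda>x. f x $ i) S"
  shows "Ck_on k f S"
proof -
  have "Ck_on k (\<lambda>x. \<Sum>i\<in>UNIV. f x $ i *\<^sub>R (axis i 1 :: real^'n)) S"
    by (intro Ck_on_sum Ck_on_scaleR Ck_on_const assms)
  moreover have "(\<Sum>i\<in>UNIV. f x $ i *\<^sub>R axis i 1) = f x" for x
    by (simp add: vec_eq_iff axis_def if_distrib[of "(*) _"] cong: if_cong)
  then have "(\<lambda>x. \<Sum>i\<in>UNIV. f x $ i *\<^sub>R axis i 1) = f" by (rule ext)
  ultimately show ?thesis by (simp only:)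
qed

lemma Ck_on_vec_nth:
  fixes f :: "'e::euclidean_space \<Rightarrow> real^'n"
  assumes "open S" "Ck_on k f S"
  shows "Ck_on k (\<lambda>x. f x $ i) S"
  by (rule Ck_on_linear_compose[OF assms(1) bounded_linear_vec_nth assms(2)])

lemma Ck_on_det:
  fixes A :: "'e::euclidean_space \<Rightarrow> real^'n^'n"
  assumes "open S" "\<And>i j. Ck_on k (\<lambda>x. A x $ i $ j) S"
  shows "Ck_on k (\<lambda>x. det (A x)) S"
  unfolding det_def by (intro Ck_on_sum Ck_on_mult Ck_on_prod Ck_on_const assms)

text \<open>Cramer's rule writes the solution as a quotient of determinants, which are polynomials
  in the entries. This gives the regularity both of the derivative of a local inverse and of the
  components of \<open>sharp\<close>.\<close>

lemma Ck_on_cramer: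
  fixes A :: "'e::euclidean_space \<Rightarrow> real^'n^'n" and b x :: "'e \<Rightarrow> real^'n"
  assumes S: "open S" and A: "\<And>i j. Ck_on k (\<lambda>y. A y $ i $ j) S"
    and b: "\<And>i. Ck_on k (\<lambda>y. b y $ i) S"
    and det: "\<And>y. y \<in> S \<Longrightarrow> det (A y) \<noteq> 0" and eq: "\<And>y. y \<in> S \<Longrightarrow> A y *v x y = b y"
  shows "Ck_on k x S"
proof (rule Ck_on_vec[OF S])
  fix l
  have entry: "Ck_on k (\<lambda>y. (\<chi> i j. if j = l then b y $ i else A y $ i $ j) $ i $ j) S" for i j
    by (cases "j = l") (simp_all add: A b)
  have inv: "Ck_on k (inverse \<circ> (\<lambda>y. det (A y))) S"
    by (rule Ck_on_compose[OF S _ _ Ck_on_det[OF S A] Ck_on_inverse]) (use det in auto)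
  have "Ck_on k (\<lambda>y. det (\<chi> i j. if j = l then b y $ i else A y $ i $ j) *
      (inverse \<circ> (\<lambda>y. det (A y))) y) S"
    by (intro Ck_on_mult[OF S] inv Ck_on_det[OF S] entry)
  then show "Ck_on k (\<lambda>y. x y $ l) S"
  proof (rule Ck_on_cong[OF S, rotated])
    fix y assume y: "y \<in> S"
    have "x y = (\<chi> k. det (\<chi> i j. if j = k then b y $ i else A y $ i $ j) / det (A y))"
      using cramer[OF det[OF y]] eq[OF y] by blast
    then show "det (\<chi> i j. if j = l then b y $ i else A y $ i $ j) *
      (inverse \<circ> (\<lambda>y. det (A y))) y = x y $ l"
      by (simp add: divide_inverse)
  qed
qed

section \<open>Smooth maps and the smooth inverse function theorem\<close>

lemma smooth_on_frechet:
  assumes "smooth_on f S"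
  shows "smooth_on (\<lambda>x. frechet_derivative f (at x) v) S"
  using assms unfolding smooth_on_def by (metis Ck_on.simps(2))

lemma smooth_on_has_derivative:
  assumes "smooth_on f S" "x \<in> S"
  shows "(f has_derivative frechet_derivative f (at x)) (at x)"
  using assms Ck_on_SucD unfolding smooth_on_def by metis

text \<open>The C^1 theorem provides \<open>G\<close>, and its smoothness is bootstrapped: the
  derivative \<open>g' y v\<close> solves a linear system whose matrix is the Jacobian of
  \<open>F\<close> at \<open>G y\<close>. If \<open>G\<close> has order \<open>k\<close>, so has
  this matrix, hence by Cramer's rule the derivative, and \<open>G\<close> has order
  \<open>k + 1\<close>.\<close>

lemma smooth_on_inverse_function:
  fixes F :: "real^'n \<Rightarrow> real^'n"
  assumes U: "open U" and F: "smooth_on F U" and x0: "x0 \<in> U"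
    and det: "det (matrix (frechet_derivative F (at x0))) \<noteq> 0"
  obtains V W G where "open V" "V \<subseteq> U" "x0 \<in> V" "open W" "homeomorphism V W F G" "smooth_on G W"
proof -
  \<comment> \<open>The inverse function theorem takes the derivative as a continuous map into the
    bounded linear maps. Continuity is checked on single directions, where it is part of the
    smoothness of \<open>F\<close>.\<close>
  define F' where "F' x = Blinfun (frechet_derivative F (at x))" for x
  have app: "blinfun_apply (F' x) = frechet_derivative F (at x)" if "x \<in> U" for x
    unfolding F'_def using smooth_on_has_derivative[OF F that]
    by (intro bounded_linear_Blinfun_apply has_derivative_bounded_linear)
  have der: "(F has_derivative blinfun_apply (F' x)) (at x)" if "x \<in> U" for x
    using smooth_on_has_derivative[OF F that] app[OF that] by simp
  have cont: "continuous_on U F'"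
  proof (rule continuous_on_blinfun_componentwise)
    fix i :: "real^'n"
    have "continuous_on U (\<lambda>x. frechet_derivative F (at x) i)"
      using smooth_on_frechet[OF F] unfolding smooth_on_def by (metis Ck_on.simps(1))
    then show "continuous_on U (\<lambda>x. blinfun_apply (F' x) i)"
      using app continuous_on_cong by fastforce
  qed
  have lin: "linear (frechet_derivative F (at x0))"
    using der[OF x0] app[OF x0] has_derivative_linear by metis
  then have "inj (frechet_derivative F (at x0))"
    using det det_nz_iff_inj by blast
  then obtain h where h: "linear h" "h \<circ> frechet_derivative F (at x0) = id"
    using linear_injective_left_inverse[OF lin] by blast
  have inv: "Blinfun h o\<^sub>L F' x0 = id_blinfun"
  proof (rule blinfun_eqI)
    fix v
    have "bounded_linear h" using h(1) by (simp add: linear_conv_bounded_linear)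
    then show "blinfun_apply (Blinfun h o\<^sub>L F' x0) v = blinfun_apply id_blinfun v"
      using fun_cong[OF h(2), of v] app[OF x0] by (simp add: bounded_linear_Blinfun_apply)
  qed
  obtain V W G g' where VW: "open V" "V \<subseteq> U" "x0 \<in> V" "open W" "F x0 \<in> W"
    "homeomorphism V W F G" "\<And>y. y \<in> W \<Longrightarrow> (G has_derivative (g' y)) (at y)"
    "\<And>y. y \<in> W \<Longrightarrow> g' y = inv (blinfun_apply (F' (G y)))"
    "\<And>y. y \<in> W \<Longrightarrow> bij (blinfun_apply (F' (G y)))"
    using inverse_function_theorem[OF U der cont x0 inv] by metis
  have GV: "G y \<in> V" if "y \<in> W" for y using VW(6) that unfolding homeomorphism_def by blast
  let ?A = "\<lambda>y. matrix (frechet_derivative F (at (G y)))"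
  have linG: "linear (frechet_derivative F (at (G y)))" if "y \<in> W" for y
    using der[of "G y"] app[of "G y"] GV[OF that] VW(2) has_derivative_linear by (metis subsetD)
  have appG: "blinfun_apply (F' (G y)) = frechet_derivative F (at (G y))" if "y \<in> W" for y
    using app GV[OF that] VW(2) by auto
  have "Ck_on k G W" for k
  proof (induction k)
    case 0
    then show ?case using VW(6) unfolding homeomorphism_def by simp
  next
    case (Suc k)
    show ?case
    proof (rule Ck_on_SucI[OF VW(4) VW(7)])
      fix v
      show "Ck_on k (\<lambda>y. g' y v) W"
      proof (rule Ck_on_cramer[OF VW(4), where A = ?A and b = "\<lambda>_. v"])
        fix i j
        have "smooth_on (\<lambda>x. frechet_derivative F (at x) (axis j 1)) V"
          using smooth_on_frechet[OF F] Ck_on_subset[OF _ VW(2)] unfolding smooth_on_def by blast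
        then have "Ck_on k ((\<lambda>x. frechet_derivative F (at x) (axis j 1)) \<circ> G) W"
          unfolding smooth_on_def using GV by (intro Ck_on_compose[OF VW(4,1) _ Suc]) auto
        from Ck_on_vec_nth[OF VW(4) this, of i]
        show "Ck_on k (\<lambda>y. ?A y $ i $ j) W" by (simp add: matrix_def)
      next
        fix y assume y: "y \<in> W"
        show "det (?A y) \<noteq> 0"
          using VW(9)[OF y] appG[OF y] det_nz_iff_inj[OF linG[OF y]] by (simp add: bij_def)
        show "?A y *v g' y v = v"
          using fun_cong[OF matrix_vector_mul(2)[OF linG[OF y]], of "g' y v"] VW(8,9)[OF y] appG[OF y]
          by (simp add: bij_def surj_f_inv_f)
      qed (auto intro: Ck_on_const)
    qed
  qed
  then show ?thesis using that VW unfolding smooth_on_def by blast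
qed

section \<open>Determinants\<close>

text \<open>The differential of \<open>det\<close> at \<open>A\<close> in direction
  \<open>B\<close>, organized by rows. This is the shape of the sum in \<open>cov_top_form\<close>,
  where one argument at a time is replaced.\<close>

definition det_derivative :: "real^'n^'n \<Rightarrow> real^'n^'n \<Rightarrow> real" where
  "det_derivative A B = (\<Sum>i\<in>UNIV. det (\<chi> k. if k = i then B $ i else A $ k))"

text \<open>Differentiating the Leibniz formula gives a sum over permutations and over the factor
  that is differentiated. With the two sums exchanged, the inner one is the Leibniz formula of the
  matrix with one row replaced.\<close>

lemma has_derivative_det:
  fixes A :: "real^'n^'n"
  shows "(det has_derivative det_derivative A) (at A)"
proof -
  have nth: "((\<lambda>A::real^'n^'n. A $ i $ j) has_derivative (\<lambda>B. B $ i $ j)) (at A)" for i j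
    by (intro bounded_linear_imp_has_derivative
        bounded_linear_compose[OF bounded_linear_vec_nth bounded_linear_vec_nth])
  have "(det has_derivative (\<lambda>B. \<Sum>p | p permutes (UNIV::'n set). of_int (sign p) *
      (\<Sum>i\<in>UNIV. B $ i $ p i * (\<Prod>j\<in>UNIV - {i}. A $ j $ p j)))) (at A)"
    unfolding det_def by (intro has_derivative_sum has_derivative_mult_right has_derivative_prod nth)
  moreover have "(\<Sum>p | p permutes (UNIV::'n set). of_int (sign p) *
      (\<Sum>i\<in>UNIV. B $ i $ p i * (\<Prod>j\<in>UNIV - {i}. A $ j $ p j)))
    = (\<Sum>i\<in>UNIV. det (\<chi> k. if k = i then B $ i else A $ k))" for B
  proof -
    have "(\<Prod>k\<in>UNIV. (if k = i then B $ i else A $ k) $ p k)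
        = B $ i $ p i * (\<Prod>j\<in>UNIV - {i}. A $ j $ p j)" for i p
      by (subst prod.remove[of _ i]) (auto intro!: prod.cong)
    then show ?thesis
      unfolding det_def by (subst sum.swap) (simp add: sum_distrib_left if_distrib cong: if_cong)
  qed
  ultimately show ?thesis by (simp add: det_derivative_def[abs_def])
qed

lemma linear_det_derivative: "linear (det_derivative A)"
  using has_derivative_det has_derivative_linear by blast

text \<open>Row \<open>i\<close> of \<open>B ** A\<close> is a combination of the rows of
  \<open>A\<close>. Put in place of row \<open>i\<close>, only the multiple of that row itself
  survives in the determinant, with coefficient \<open>B $ i $ i\<close>.\<close>

lemma det_derivative_left:
  fixes A B :: "real^'n^'n"
  shows "det_derivative A (B ** A) = trace B * det A"
proof -
  have "det (\<chi> k. if k = i then (B ** A) $ i else A $ k) = B $ i $ i * det A" for i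
  proof -
    have "(B ** A) $ i = (\<Sum>j\<in>UNIV. (B $ i) $ j *s row j A)"
      by (simp add: vec_eq_iff matrix_matrix_mult_def row_def)
    moreover have "A $ k = row k A" for k by (simp add: row_def vec_eq_iff)
    ultimately show ?thesis using cramer_lemma_transpose[of i "B $ i" A] by (simp add: cong: if_cong)
  qed
  then show ?thesis by (simp add: det_derivative_def trace_def sum_distrib_right)
qed

text \<open>Invariance of the differential of \<open>det\<close> under transposition reduces this to the row version.\<close>

lemma det_derivative_right:
  fixes A B :: "real^'n^'n"
  shows "det_derivative A (A ** B) = trace B * det A"
proof -
  have "bounded_linear (transpose :: real^'n^'n \<Rightarrow> _)"
    by (auto simp: linear_conv_bounded_linear[symmetric] linear_iff vec_eq_iff transpose_def)
  then have "((det \<circ> transpose) has_derivative (det_derivative (transpose A) \<circ> transpose)) (at A)"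
    by (intro diff_chain_at has_derivative_det bounded_linear_imp_has_derivative)
  then have "(det has_derivative (det_derivative (transpose A) \<circ> transpose)) (at A)"
    by (simp add: o_def)
  then have "det_derivative A = det_derivative (transpose A) \<circ> transpose"
    using has_derivative_unique[OF has_derivative_det] by blast
  from fun_cong[OF this, of "A ** B"]
  have "det_derivative A (A ** B) = det_derivative (transpose A) (transpose B ** transpose A)"
    unfolding o_def matrix_transpose_mul .
  then show ?thesis
    unfolding det_derivative_left det_transpose by (simp add: trace_def transpose_def)
qed

lemma det_neq_0I:
  fixes A :: "real^'n^'n"
  assumes "\<And>x. A *v x = 0 \<Longrightarrow> x = 0"
  shows "det A \<noteq> 0"
  using assms matrix_left_invertible_ker[of A] invertible_left_inverse[of A] invertible_det_nz[of A] by blast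

text \<open>The segment from the identity matrix to a positive definite matrix avoids the zeros of
  \<open>det\<close>.\<close>

lemma det_positive_definite:
  fixes A :: "real^'n^'n"
  assumes "\<And>x. x \<noteq> 0 \<Longrightarrow> x \<bullet> (A *v x) > 0"
  shows "det A > 0"
proof (rule ccontr)
  assume "\<not> det A > 0"
  define B where "B t = (1 - t) *\<^sub>R mat 1 + t *\<^sub>R A" for t
  have "continuous_on {0..1} (\<lambda>t. det (B t))"
    unfolding det_def B_def by (auto intro!: continuous_intros)
  moreover have "det (B 0) = 1" "det (B 1) = det A" by (simp_all add: B_def)
  ultimately obtain t where t: "0 \<le> t" "t \<le> 1" "det (B t) = 0"
    using IVT2'[of "\<lambda>t. det (B t)" 1 0 0] \<open>\<not> det A > 0\<close> by auto
  have "det (B t) \<noteq> 0"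
  proof (rule det_neq_0I, rule ccontr)
    fix x assume x: "B t *v x = 0" "x \<noteq> 0"
    have "x \<bullet> (B t *v x) = (1 - t) * (x \<bullet> x) + t * (x \<bullet> (A *v x))"
      by (simp add: B_def matrix_vector_mult_add_rdistrib inner_add_right scaleR_matrix_vector_assoc[symmetric])
    moreover have "(1 - t) * (x \<bullet> x) + t * (x \<bullet> (A *v x)) > 0"
      using t(1,2) assms[OF x(2)] x(2)
      by (cases "t = 0") (auto intro: add_nonneg_pos)
    ultimately show False using x(1) by simp
  qed
  with t(3) show False by simp
qed

section \<open>Smooth functions and tangent vectors\<close>

lemma has_derivative_vecI:
  fixes f :: "'a::real_normed_vector \<Rightarrow> 'b::euclidean_space^'n"
  assumes "\<And>i. ((\<lambda>x. f x $ i) has_derivative (\<lambda>h. f' h $ i)) (at a)"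
  shows "(f has_derivative f') (at a)"
  unfolding has_derivative_componentwise_within[of f]
proof
  fix e :: "'b^'n" assume "e \<in> Basis"
  then obtain i b where e: "e = axis i b" by (auto simp: Basis_vec_def)
  show "((\<lambda>x. f x \<bullet> e) has_derivative (\<lambda>h. f' h \<bullet> e)) (at a)"
    unfolding e inner_axis using assms[of i] by (rule has_derivative_inner_left)
qed

lemma smooth_on_cong:
  "open S \<Longrightarrow> (\<And>x. x \<in> S \<Longrightarrow> f x = g x) \<Longrightarrow> smooth_on f S \<Longrightarrow> smooth_on g S"
  unfolding smooth_on_def using Ck_on_cong by blast

lemma smooth_on_subset: "smooth_on f S \<Longrightarrow> T \<subseteq> S \<Longrightarrow> smooth_on f T"
  unfolding smooth_on_def using Ck_on_subset by blast

lemma smooth_on_local: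
  "(\<And>x. x \<in> S \<Longrightarrow> \<exists>T. open T \<and> x \<in> T \<and> smooth_on f T) \<Longrightarrow> smooth_on f S"
  unfolding smooth_on_def by (meson Ck_on_local)

lemma smooth_on_compose:
  fixes f :: "'e::euclidean_space \<Rightarrow> 'f::euclidean_space" and g :: "'f \<Rightarrow> 'g::real_normed_vector"
  shows "open S \<Longrightarrow> open T \<Longrightarrow> f ` S \<subseteq> T \<Longrightarrow> smooth_on f S \<Longrightarrow> smooth_on g T \<Longrightarrow>
    smooth_on (g \<circ> f) S"
  unfolding smooth_on_def using Ck_on_compose[of S T f _ g] by blast

section \<open>Charts and smooth functions on the manifold\<close>

abbreviation coord :: "'a set \<times> ('a \<Rightarrow> real^'n) \<Rightarrow> 'n \<Rightarrow> 'a \<Rightarrow> real" where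
  "coord c j \<equiv> \<lambda>q. snd c q $ j"

text \<open>This and the next lemma speak of any \<open>is_chart\<close>, not only of members of the
  atlas, because \<open>chart_from_functions\<close> uses them before its new chart is known to be
  in the atlas.\<close>

lemma chart_inv_image: "is_chart T c \<Longrightarrow> p \<in> fst c \<Longrightarrow> chart_inv c (snd c p) = p"
  unfolding is_chart_def chart_inv_def
  by (metis homeomorphic_imp_injective_map inv_into_f_f openin_subset topspace_subtopology_subset)

lemma is_chart_open_image:
  assumes c: "is_chart T c" and U: "openin T U"
  shows "open (snd c ` (fst c \<inter> U))"
proof -
  have "homeomorphic_map (subtopology T (fst c)) (top_of_set (snd c ` fst c)) (snd c)"
    and o: "open (snd c ` fst c)"
    using c unfolding is_chart_def by auto
  moreover have "openin (subtopology T (fst c)) (fst c \<inter> U)"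
    using U by (simp add: openin_subtopology_Int2)
  ultimately have "openin (top_of_set (snd c ` fst c)) (snd c ` (fst c \<inter> U))"
    using homeomorphic_imp_open_map unfolding open_map_def by blast
  then show ?thesis using o openin_open_trans by blast
qed

locale smooth_mfd =
  fixes M :: "('a, 'n::finite) mfd"
  assumes mfd: "smooth_manifold M"
begin

lemma is_chart: "c \<in> atlas M \<Longrightarrow> is_chart (mtop M) c"
  using mfd unfolding smooth_manifold_def by blast

lemma chart_open: "c \<in> atlas M \<Longrightarrow> openin (mtop M) (fst c)"
  using is_chart unfolding is_chart_def by blast

lemma chart_covers:
  assumes "p \<in> topspace (mtop M)" obtains c where "c \<in> atlas M" "p \<in> fst c"
  using mfd assms unfolding smooth_manifold_def by blast

lemma chart_inv_coord [simp]: "c \<in> atlas M \<Longrightarrow> p \<in> fst c \<Longrightarrow> chart_inv c (snd c p) = p"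
  by (rule chart_inv_image[OF is_chart])

lemma open_chart_image: "c \<in> atlas M \<Longrightarrow> openin (mtop M) U \<Longrightarrow> open (snd c ` (fst c \<inter> U))"
  using is_chart_open_image is_chart by blast

lemma open_chart_image': "c \<in> atlas M \<Longrightarrow> openin (mtop M) U \<Longrightarrow> U \<subseteq> fst c \<Longrightarrow> open (snd c ` U)"
  using open_chart_image by (metis inf.absorb_iff2)

lemma open_chart_preimage:
  assumes c: "c \<in> atlas M" and S: "open S"
  shows "openin (mtop M) {p \<in> fst c. snd c p \<in> S}"
proof -
  have "homeomorphic_map (subtopology (mtop M) (fst c)) (top_of_set (snd c ` fst c)) (snd c)"
    using is_chart[OF c] unfolding is_chart_def by auto
  then have "continuous_map (subtopology (mtop M) (fst c)) (top_of_set (snd c ` fst c)) (snd c)"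
    by (rule homeomorphic_imp_continuous_map)
  then have "continuous_map (subtopology (mtop M) (fst c)) euclidean (snd c)"
    by (simp add: continuous_map_in_subtopology)
  then have "openin (subtopology (mtop M) (fst c)) {p \<in> topspace (subtopology (mtop M) (fst c)). snd c p \<in> S}"
    using S by (simp add: continuous_map)
  moreover have "topspace (subtopology (mtop M) (fst c)) = fst c"
    using chart_open[OF c] openin_subset by fastforce
  ultimately show ?thesis
    unfolding openin_open_subtopology[OF chart_open[OF c]] by (simp only:)
qed

lemma transition_smooth:
  "c \<in> atlas M \<Longrightarrow> d \<in> atlas M \<Longrightarrow> smooth_on (snd d \<circ> chart_inv c) (snd c ` (fst c \<inter> fst d))"
  using mfd unfolding smooth_manifold_def compatible_def by blast

lemma smooth_fun_open: "smooth_fun M U f \<Longrightarrow> openin (mtop M) U"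
  unfolding smooth_fun_def by blast

lemma smooth_fun_chartD:
  assumes "c \<in> atlas M" "smooth_fun M U f"
  shows "smooth_on (f \<circ> chart_inv c) (snd c ` (fst c \<inter> U))"
  using assms unfolding smooth_fun_def by blast

text \<open>One chart containing \<open>U\<close> decides smoothness, since in any other chart the
  function is the same expression composed with a smooth transition map.\<close>

lemma smooth_fun_chartI:
  assumes c: "c \<in> atlas M" and U: "openin (mtop M) U" "U \<subseteq> fst c"
    and f: "smooth_on (f \<circ> chart_inv c) (snd c ` U)"
  shows "smooth_fun M U f"
  unfolding smooth_fun_def
proof (intro conjI ballI U)
  fix d assume d: "d \<in> atlas M"
  have oU: "open (snd d ` (fst d \<inter> U))" "open (snd c ` U)"
    using open_chart_image[OF d U(1)] open_chart_image'[OF c U] by auto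
  have tr: "smooth_on (snd c \<circ> chart_inv d) (snd d ` (fst d \<inter> U))"
    by (rule smooth_on_subset[OF transition_smooth[OF d c]]) (use U in auto)
  have "(snd c \<circ> chart_inv d) ` snd d ` (fst d \<inter> U) \<subseteq> snd c ` U"
    using d by auto
  from smooth_on_compose[OF oU this tr f]
  show "smooth_on (f \<circ> chart_inv d) (snd d ` (fst d \<inter> U))"
  proof (rule smooth_on_cong[OF oU(1), rotated])
    fix y assume "y \<in> snd d ` (fst d \<inter> U)"
    then obtain p where "p \<in> fst d" "p \<in> U" "y = snd d p" by blast
    then show "((f \<circ> chart_inv c) \<circ> (snd c \<circ> chart_inv d)) y = (f \<circ> chart_inv d) y"
      using c d U by auto
  qed
qed

lemma smooth_fun_subset:
  assumes "smooth_fun M U f" "openin (mtop M) V" "V \<subseteq> U"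
  shows "smooth_fun M V f"
  using assms unfolding smooth_fun_def by (meson Int_mono image_mono order_refl smooth_on_subset)

lemma smooth_fun_cong:
  assumes "smooth_fun M U f" "\<And>p. p \<in> U \<Longrightarrow> f p = g p"
  shows "smooth_fun M U g"
  unfolding smooth_fun_def
proof (intro conjI ballI)
  show U: "openin (mtop M) U" using assms smooth_fun_open by blast
  fix c assume c: "c \<in> atlas M"
  show "smooth_on (g \<circ> chart_inv c) (snd c ` (fst c \<inter> U))"
    by (rule smooth_on_cong[OF open_chart_image[OF c U] _ smooth_fun_chartD[OF c assms(1)]])
      (use c assms(2) in auto)
qed

lemma smooth_fun_local:
  assumes U: "openin (mtop M) U" and "\<And>p. p \<in> U \<Longrightarrow> \<exists>V. p \<in> V \<and> smooth_fun M V f"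
  shows "smooth_fun M U f"
  unfolding smooth_fun_def
proof (intro conjI ballI U)
  fix c assume c: "c \<in> atlas M"
  show "smooth_on (f \<circ> chart_inv c) (snd c ` (fst c \<inter> U))"
  proof (rule smooth_on_local)
    fix y assume "y \<in> snd c ` (fst c \<inter> U)"
    then obtain p where p: "p \<in> fst c" "p \<in> U" "y = snd c p" by blast
    obtain V where V: "p \<in> V" "smooth_fun M V f" using assms(2) p by blast
    then show "\<exists>T. open T \<and> y \<in> T \<and> smooth_on (f \<circ> chart_inv c) T"
      using open_chart_image[OF c smooth_fun_open[OF V(2)]] smooth_fun_chartD[OF c V(2)] p
      by (intro exI[of _ "snd c ` (fst c \<inter> V)"]) auto
  qed
qed

lemma smooth_fun_const: "openin (mtop M) U \<Longrightarrow> smooth_fun M U (\<lambda>_. a)"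
  unfolding smooth_fun_def smooth_on_def o_def by (simp add: Ck_on_const)

lemma smooth_fun_add: "smooth_fun M U f \<Longrightarrow> smooth_fun M U g \<Longrightarrow> smooth_fun M U (\<lambda>p. f p + g p)"
  unfolding smooth_fun_def smooth_on_def o_def using Ck_on_add[OF open_chart_image] by blast

lemma smooth_fun_mult: "smooth_fun M U f \<Longrightarrow> smooth_fun M U g \<Longrightarrow> smooth_fun M U (\<lambda>p. f p * g p)"
  unfolding smooth_fun_def smooth_on_def o_def using Ck_on_mult[OF open_chart_image] by simp

lemma smooth_fun_cmult: "smooth_fun M U f \<Longrightarrow> smooth_fun M U (\<lambda>p. a * f p)"
  using smooth_fun_mult smooth_fun_const smooth_fun_open by blast

lemma smooth_fun_diff:
  assumes "smooth_fun M U f" "smooth_fun M U g" shows "smooth_fun M U (\<lambda>p. f p - g p)"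
  using smooth_fun_add[OF assms(1) smooth_fun_cmult[OF assms(2), of "-1"]] by simp

lemma smooth_fun_sum:
  assumes "openin (mtop M) U" "\<And>i. i \<in> I \<Longrightarrow> smooth_fun M U (f i)"
  shows "smooth_fun M U (\<lambda>p. \<Sum>i\<in>I. f i p)"
  using assms(2)
  by (induction I rule: infinite_finite_induct) (simp_all add: smooth_fun_const assms(1) smooth_fun_add)

lemma smooth_fun_compose:
  fixes h :: "real \<Rightarrow> real"
  assumes "smooth_fun M U f" "open T" "f ` U \<subseteq> T" "smooth_on h T"
  shows "smooth_fun M U (\<lambda>p. h (f p))"
  unfolding smooth_fun_def
proof (intro conjI ballI)
  show U: "openin (mtop M) U" using assms smooth_fun_open by blast
  fix c assume c: "c \<in> atlas M"
  have "smooth_on (h \<circ> (f \<circ> chart_inv c)) (snd c ` (fst c \<inter> U))"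
    by (rule smooth_on_compose[OF open_chart_image[OF c U] assms(2) _
          smooth_fun_chartD[OF c assms(1)] assms(4)]) (use assms(3) c in auto)
  then show "smooth_on ((\<lambda>p. h (f p)) \<circ> chart_inv c) (snd c ` (fst c \<inter> U))"
    by (simp add: o_def)
qed

lemma smooth_fun_det:
  fixes A :: "'a \<Rightarrow> real^'m^'m"
  assumes U: "openin (mtop M) U" and "\<And>i j. smooth_fun M U (\<lambda>p. A p $ i $ j)"
  shows "smooth_fun M U (\<lambda>p. det (A p))"
  unfolding smooth_fun_def
proof (intro conjI ballI U)
  fix c assume c: "c \<in> atlas M"
  have "Ck_on k (\<lambda>x. (A \<circ> chart_inv c) x $ i $ j) (snd c ` (fst c \<inter> U))" for k i j
    using smooth_fun_chartD[OF c assms(2)[of i j]] by (simp add: smooth_on_def o_def)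
  then show "smooth_on ((\<lambda>p. det (A p)) \<circ> chart_inv c) (snd c ` (fst c \<inter> U))"
    using Ck_on_det[OF open_chart_image[OF c U], of _ "A \<circ> chart_inv c"]
    by (simp add: smooth_on_def o_def)
qed

lemma smooth_fun_cramer:
  fixes A :: "'a \<Rightarrow> real^'m^'m"
  assumes U: "openin (mtop M) U" and A: "\<And>i j. smooth_fun M U (\<lambda>p. A p $ i $ j)"
    and b: "\<And>i. smooth_fun M U (\<lambda>p. b p $ i)"
    and det: "\<And>p. p \<in> U \<Longrightarrow> det (A p) \<noteq> 0" and eq: "\<And>p. p \<in> U \<Longrightarrow> A p *v x p = b p"
  shows "smooth_fun M U (\<lambda>p. x p $ i)"
  unfolding smooth_fun_def smooth_on_def
proof (intro conjI ballI U allI)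
  fix c k assume c: "c \<in> atlas M"
  let ?S = "snd c ` (fst c \<inter> U)"
  have "Ck_on k (x \<circ> chart_inv c) ?S"
  proof (rule Ck_on_cramer[OF open_chart_image[OF c U],
        where A = "A \<circ> chart_inv c" and b = "b \<circ> chart_inv c"])
    show "Ck_on k (\<lambda>y. (A \<circ> chart_inv c) y $ i $ j) ?S" for i j
      using smooth_fun_chartD[OF c A[of i j]] by (simp add: smooth_on_def o_def)
    show "Ck_on k (\<lambda>y. (b \<circ> chart_inv c) y $ i) ?S" for i
      using smooth_fun_chartD[OF c b[of i]] by (simp add: smooth_on_def o_def)
  qed (use c det eq in auto)
  from Ck_on_vec_nth[OF open_chart_image[OF c U] this, of i]
  show "Ck_on k ((\<lambda>p. x p $ i) \<circ> chart_inv c) ?S" by (simp add: o_def)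
qed

lemma smooth_fun_coord:
  assumes c: "c \<in> atlas M"
  shows "smooth_fun M (fst c) (coord c j)"
  unfolding smooth_fun_def smooth_on_def
proof (intro conjI ballI chart_open[OF c] allI)
  fix d k assume d: "d \<in> atlas M"
  have "Ck_on k (snd c \<circ> chart_inv d) (snd d ` (fst d \<inter> fst c))"
    using transition_smooth[OF d c] unfolding smooth_on_def by blast
  from Ck_on_vec_nth[OF open_chart_image[OF d chart_open[OF c]] this, of j]
  show "Ck_on k (coord c j \<circ> chart_inv d) (snd d ` (fst d \<inter> fst c))" by (simp add: o_def)
qed

section \<open>Directional derivatives and change of chart\<close>

lemma smooth_nearI: "smooth_fun M U f \<Longrightarrow> p \<in> U \<Longrightarrow> smooth_near M p f"
  unfolding smooth_near_def by blast

lemma smooth_near_coord: "c \<in> atlas M \<Longrightarrow> p \<in> fst c \<Longrightarrow> smooth_near M p (coord c j)"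
  using smooth_nearI smooth_fun_coord by blast

lemma smooth_near_cong:
  assumes U: "openin (mtop M) U" "p \<in> U" and eq: "\<And>q. q \<in> U \<Longrightarrow> f q = g q"
  shows "smooth_near M p f \<longleftrightarrow> smooth_near M p g"
proof -
  have *: "smooth_near M p g" if f: "smooth_near M p f" and eq: "\<And>q. q \<in> U \<Longrightarrow> f q = g q" for f g
  proof -
    obtain V where V: "p \<in> V" "smooth_fun M V f" using f unfolding smooth_near_def by blast
    have "smooth_fun M (U \<inter> V) f"
      by (rule smooth_fun_subset[OF V(2)]) (use U smooth_fun_open[OF V(2)] in auto)
    then have "smooth_fun M (U \<inter> V) g" by (rule smooth_fun_cong) (use eq in auto)
    then show ?thesis using U V smooth_nearI by blast
  qed
  show ?thesis using *[of f g, OF _ eq] *[of g f, OF _ eq[symmetric]] by blast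
qed

lemma smooth_near_has_derivative:
  assumes c: "c \<in> atlas M" "p \<in> fst c" and f: "smooth_near M p f"
  shows "((f \<circ> chart_inv c) has_derivative frechet_derivative (f \<circ> chart_inv c) (at (snd c p))) (at (snd c p))"
proof -
  obtain V where V: "p \<in> V" "smooth_fun M V f" using f unfolding smooth_near_def by blast
  show ?thesis
    by (rule smooth_on_has_derivative[OF smooth_fun_chartD[OF c(1) V(2)]]) (use V c in auto)
qed

lemma dir_deriv_eq:
  assumes "smooth_near M p f" "((f \<circ> chart_inv c) has_derivative f') (at (snd c p))"
  shows "dir_deriv M c p w f = f' w"
  using assms frechet_derivative_at unfolding dir_deriv_def by metis

lemma dir_deriv_lincomb:
  assumes c: "c \<in> atlas M" "p \<in> fst c"
  shows "dir_deriv M c p (a *\<^sub>R v + b *\<^sub>R w) f = a * dir_deriv M c p v f + b * dir_deriv M c p w f"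
proof (cases "smooth_near M p f")
  case True
  then have "linear (frechet_derivative (f \<circ> chart_inv c) (at (snd c p)))"
    using smooth_near_has_derivative[OF c True] has_derivative_linear by blast
  then show ?thesis using True by (simp add: dir_deriv_def linear_add linear_scale)
qed (simp add: dir_deriv_def)

lemma dir_deriv_sum:
  assumes c: "c \<in> atlas M" "p \<in> fst c"
  shows "dir_deriv M c p w f = (\<Sum>j\<in>UNIV. w $ j * coord_field M c j p f)"
proof (cases "smooth_near M p f")
  case True
  let ?L = "frechet_derivative (f \<circ> chart_inv c) (at (snd c p))"
  have lin: "linear ?L"
    using smooth_near_has_derivative[OF c True] has_derivative_linear by blast
  have "?L (\<Sum>j\<in>UNIV. w $ j *\<^sub>R axis j 1) = (\<Sum>j\<in>UNIV. w $ j * ?L (axis j 1))"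
    by (simp add: linear_sum[OF lin] linear_scale[OF lin])
  moreover have "(\<Sum>j\<in>UNIV. w $ j *\<^sub>R axis j 1) = w"
    by (simp add: vec_eq_iff axis_def if_distrib[of "(*) _"] cong: if_cong)
  ultimately show ?thesis using True by (simp add: dir_deriv_def coord_field_def)
qed (simp add: dir_deriv_def coord_field_def)

text \<open>By the chain rule the direction transforms with the derivative of the transition map.
  Hence the union over all charts in \<open>tangent_space\<close> is already exhausted by any single
  chart around \<open>p\<close>, which makes it a vector space.\<close>

lemma dir_deriv_change_chart:
  assumes c: "c \<in> atlas M" "p \<in> fst c" and d: "d \<in> atlas M" "p \<in> fst d"
  obtains w' where "dir_deriv M d p w = dir_deriv M c p w'"
proof
  let ?T = "frechet_derivative (snd c \<circ> chart_inv d) (at (snd d p))"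
  show "dir_deriv M d p w = dir_deriv M c p (?T w)"
  proof
    fix f
    show "dir_deriv M d p w f = dir_deriv M c p (?T w) f"
    proof (cases "smooth_near M p f")
      case True
      have "((snd c \<circ> chart_inv d) has_derivative ?T) (at (snd d p))"
        by (rule smooth_on_has_derivative[OF transition_smooth[OF d(1) c(1)]]) (use c d in auto)
      from diff_chain_at[OF this, of "f \<circ> chart_inv c"] smooth_near_has_derivative[OF c True] d
      have "((f \<circ> chart_inv c) \<circ> (snd c \<circ> chart_inv d) has_derivative
          (frechet_derivative (f \<circ> chart_inv c) (at (snd c p)) \<circ> ?T)) (at (snd d p))" by simp
      then have "((f \<circ> chart_inv d) has_derivative
          (frechet_derivative (f \<circ> chart_inv c) (at (snd c p)) \<circ> ?T)) (at (snd d p))"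
      proof (rule has_derivative_transform_within_open)
        show "open (snd d ` (fst d \<inter> fst c))" "snd d p \<in> snd d ` (fst d \<inter> fst c)"
          using open_chart_image[OF d(1) chart_open[OF c(1)]] c d by auto
      qed (use c d in auto)
      from dir_deriv_eq[OF True this] show ?thesis using True by (simp add: dir_deriv_def)
    qed (simp add: dir_deriv_def)
  qed
qed

lemma tangent_in_chart:
  assumes "v \<in> tangent_space M p" "c \<in> atlas M" "p \<in> fst c"
  obtains w where "v = dir_deriv M c p w"
  using assms dir_deriv_change_chart unfolding tangent_space_def mem_Collect_eq by metis

lemma dir_deriv_tangent: "c \<in> atlas M \<Longrightarrow> p \<in> fst c \<Longrightarrow> dir_deriv M c p w \<in> tangent_space M p"
  unfolding tangent_space_def by blast

lemma dir_deriv_coord: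
  assumes c: "c \<in> atlas M" "p \<in> fst c"
  shows "dir_deriv M c p w (coord c j) = w $ j"
proof (rule dir_deriv_eq[OF smooth_near_coord[OF c]])
  have "((\<lambda>y::real^'n. y $ j) has_derivative (\<lambda>w. w $ j)) (at (snd c p))"
    by (rule bounded_linear_imp_has_derivative[OF bounded_linear_vec_nth])
  then show "(coord c j \<circ> chart_inv c has_derivative (\<lambda>w. w $ j)) (at (snd c p))"
  proof (rule has_derivative_transform_within_open)
    show "open (snd c ` (fst c \<inter> fst c))" "snd c p \<in> snd c ` (fst c \<inter> fst c)"
      using open_chart_image[OF c(1) chart_open[OF c(1)]] c by auto
  qed (use c in auto)
qed

text \<open>The direction of a tangent vector in a chart is read off from its values on the
  coordinate functions. This reduces identities of vectors to n numbers and smoothness of fields to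
  n functions; for \<open>f\<close> not smooth near \<open>p\<close> both sides take the default
  value 0.\<close>

lemma tangent_expand:
  assumes "v \<in> tangent_space M p" "c \<in> atlas M" "p \<in> fst c"
  shows "v f = (\<Sum>j\<in>UNIV. v (coord c j) * coord_field M c j p f)"
proof -
  obtain w where w: "v = dir_deriv M c p w" using tangent_in_chart[OF assms] .
  show ?thesis unfolding w dir_deriv_coord[OF assms(2,3)] by (rule dir_deriv_sum[OF assms(2,3)])
qed

lemma tangent_eqI:
  assumes "v \<in> tangent_space M p" "v' \<in> tangent_space M p" "c \<in> atlas M" "p \<in> fst c"
    and "\<And>j. v (coord c j) = v' (coord c j)"
  shows "v = v'"
proof
  fix f
  show "v f = v' f"
    unfolding tangent_expand[OF assms(1,3,4), of f] tangent_expand[OF assms(2,3,4), of f] assms(5) ..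
qed

lemma coord_field_coord:
  "c \<in> atlas M \<Longrightarrow> p \<in> fst c \<Longrightarrow> coord_field M c i p (coord c j) = (if i = j then 1 else 0)"
  unfolding coord_field_def by (simp add: dir_deriv_coord axis_def)

lemma coord_field_tangent: "c \<in> atlas M \<Longrightarrow> p \<in> fst c \<Longrightarrow> coord_field M c i p \<in> tangent_space M p"
  unfolding coord_field_def by (rule dir_deriv_tangent)

lemma tangent_topspace:
  assumes "v \<in> tangent_space M p"
  obtains c where "c \<in> atlas M" "p \<in> fst c"
  using assms unfolding tangent_space_def by blast

lemma topspace_chart: "c \<in> atlas M \<Longrightarrow> p \<in> fst c \<Longrightarrow> p \<in> topspace (mtop M)"
  using chart_open openin_subset by blast

lemma tangent_in_topspace: "v \<in> tangent_space M p \<Longrightarrow> p \<in> topspace (mtop M)"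
  using tangent_topspace topspace_chart by metis

lemma tangent_lincomb:
  assumes "v \<in> tangent_space M p" "w \<in> tangent_space M p"
  shows "(\<lambda>f. a * v f + b * w f) \<in> tangent_space M p"
proof -
  obtain c where c: "c \<in> atlas M" "p \<in> fst c" using tangent_topspace[OF assms(1)] .
  obtain v' w' where eq: "v = dir_deriv M c p v'" "w = dir_deriv M c p w'"
    using tangent_in_chart[OF _ c] assms by metis
  have "(\<lambda>f. a * v f + b * w f) = dir_deriv M c p (a *\<^sub>R v' + b *\<^sub>R w')"
    unfolding eq using dir_deriv_lincomb[OF c] by auto
  then show ?thesis using dir_deriv_tangent[OF c] by simp
qed

lemma tangent_zero:
  assumes "p \<in> topspace (mtop M)" shows "(\<lambda>_. 0) \<in> tangent_space M p"
proof -
  obtain c where "c \<in> atlas M" "p \<in> fst c" using chart_covers[OF assms] .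
  then have v: "dir_deriv M c p 0 \<in> tangent_space M p" by (rule dir_deriv_tangent)
  from tangent_lincomb[OF v v, of 0 0] show ?thesis by simp
qed

lemma tangent_sum:
  assumes "p \<in> topspace (mtop M)" "\<And>i. i \<in> I \<Longrightarrow> v i \<in> tangent_space M p"
  shows "(\<lambda>f. \<Sum>i\<in>I. a i * v i f) \<in> tangent_space M p"
  using assms(2)
proof (induction I rule: infinite_finite_induct)
  case (insert i I)
  then have "(\<lambda>f. a i * v i f + 1 * (\<Sum>i\<in>I. a i * v i f)) \<in> tangent_space M p"
    by (intro tangent_lincomb) auto
  with insert show ?case by simp
qed (simp_all add: tangent_zero assms(1))

lemma tangent_smooth_near: "v \<in> tangent_space M p \<Longrightarrow> \<not> smooth_near M p f \<Longrightarrow> v f = 0"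
  unfolding tangent_space_def by (auto simp: dir_deriv_def)

text \<open>Locality of tangent vectors. It is needed whenever a vector acts on a function such as
  \<open>\<lambda>q. Y q f\<close> that is known only on an open set; when \<open>f\<close> is not
  smooth near \<open>p\<close>, neither is \<open>g\<close>, and both values are the default
  0.\<close>

lemma tangent_cong:
  assumes v: "v \<in> tangent_space M p" and U: "openin (mtop M) U" "p \<in> U"
    and eq: "\<And>q. q \<in> U \<Longrightarrow> f q = g q"
  shows "v f = v g"
proof (cases "smooth_near M p f")
  case True
  then have gn: "smooth_near M p g" using smooth_near_cong[of U p f g, OF U eq] by blast
  obtain c w where c: "c \<in> atlas M" "p \<in> fst c" and vw: "v = dir_deriv M c p w"
    using v unfolding tangent_space_def by blast
  note der = smooth_near_has_derivative[OF c] and vf = dir_deriv_eq[of p _ c _ w, folded vw]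
  have "((g \<circ> chart_inv c) has_derivative frechet_derivative (f \<circ> chart_inv c) (at (snd c p))) (at (snd c p))"
    using der[OF True]
  proof (rule has_derivative_transform_within_open)
    show "open (snd c ` (fst c \<inter> U))" "snd c p \<in> snd c ` (fst c \<inter> U)"
      using open_chart_image[OF c(1) U(1)] c U by auto
  qed (use c eq in auto)
  from vf[OF gn this] vf[OF True der[OF True]] show ?thesis by simp
next
  case False
  then have "\<not> smooth_near M p g" using smooth_near_cong[of U p f g, OF U eq] by blast
  then show ?thesis using False tangent_smooth_near[OF v] by simp
qed

section \<open>Tangent vectors as derivations\<close>

lemma smooth_near_const: "p \<in> topspace (mtop M) \<Longrightarrow> smooth_near M p (\<lambda>_. a)"
  using smooth_nearI[OF smooth_fun_const[OF openin_topspace]] .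

lemma smooth_near_common:
  assumes "smooth_near M p f" "smooth_near M p g"
  obtains U where "p \<in> U" "smooth_fun M U f" "smooth_fun M U g"
proof -
  obtain V W where VW: "p \<in> V" "smooth_fun M V f" "p \<in> W" "smooth_fun M W g"
    using assms unfolding smooth_near_def by blast
  then have "openin (mtop M) (V \<inter> W)" using smooth_fun_open by blast
  then show ?thesis using that[of "V \<inter> W"] VW smooth_fun_subset by blast
qed

lemma smooth_near_add:
  assumes "smooth_near M p f" "smooth_near M p g" shows "smooth_near M p (\<lambda>q. f q + g q)"
  by (rule smooth_near_common[OF assms]) (rule smooth_nearI[OF smooth_fun_add])

lemma smooth_near_mult:
  assumes "smooth_near M p f" "smooth_near M p g" shows "smooth_near M p (\<lambda>q. f q * g q)"
  by (rule smooth_near_common[OF assms]) (rule smooth_nearI[OF smooth_fun_mult])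

lemma tangent_const:
  assumes v: "v \<in> tangent_space M p"
  shows "v (\<lambda>_. a) = 0"
proof -
  have p: "p \<in> topspace (mtop M)" by (rule tangent_in_topspace[OF v])
  obtain c w where c: "c \<in> atlas M" "p \<in> fst c" and vw: "v = dir_deriv M c p w"
    using v unfolding tangent_space_def by blast
  note vf = dir_deriv_eq[of p _ c _ w, folded vw]
  have "((\<lambda>_::'a. a) \<circ> chart_inv c has_derivative (\<lambda>_. 0)) (at (snd c p))"
    by (simp add: o_def)
  from vf[OF smooth_near_const[OF p] this] show ?thesis by simp
qed

lemma tangent_add:
  assumes v: "v \<in> tangent_space M p" and f: "smooth_near M p f" and g: "smooth_near M p g"
  shows "v (\<lambda>q. f q + g q) = v f + v g"
proof -
  obtain c w where c: "c \<in> atlas M" "p \<in> fst c" and vw: "v = dir_deriv M c p w"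
    using v unfolding tangent_space_def by blast
  note der = smooth_near_has_derivative[OF c] and vf = dir_deriv_eq[of p _ c _ w, folded vw]
  show ?thesis
    using vf[OF smooth_near_add[OF f g]] has_derivative_add[OF der[OF f] der[OF g]]
      vf[OF f der[OF f]] vf[OF g der[OF g]] by (simp add: o_def)
qed

lemma tangent_mult:
  assumes v: "v \<in> tangent_space M p" and f: "smooth_near M p f" and g: "smooth_near M p g"
  shows "v (\<lambda>q. f q * g q) = f p * v g + v f * g p"
proof -
  obtain c w where c: "c \<in> atlas M" "p \<in> fst c" and vw: "v = dir_deriv M c p w"
    using v unfolding tangent_space_def by blast
  note der = smooth_near_has_derivative[OF c] and vf = dir_deriv_eq[of p _ c _ w, folded vw]
  show ?thesis
    using vf[OF smooth_near_mult[OF f g]] has_derivative_mult[OF der[OF f] der[OF g]]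
      vf[OF f der[OF f]] vf[OF g der[OF g]] c by (simp add: o_def)
qed

lemma tangent_cmult:
  assumes v: "v \<in> tangent_space M p" and f: "smooth_near M p f"
  shows "v (\<lambda>q. a * f q) = a * v f"
proof -
  have "p \<in> topspace (mtop M)" by (rule tangent_in_topspace[OF v])
  from tangent_mult[OF v smooth_near_const[OF this] f] tangent_const[OF v] show ?thesis by simp
qed

lemma tangent_diff:
  assumes v: "v \<in> tangent_space M p" and f: "smooth_near M p f" and g: "smooth_near M p g"
  shows "v (\<lambda>q. f q - g q) = v f - v g"
proof -
  have "smooth_near M p (\<lambda>q. (-1) * g q)"
    using g smooth_fun_cmult unfolding smooth_near_def by blast
  from tangent_add[OF v f this] tangent_cmult[OF v g, of "-1"] show ?thesis by simp
qed

text \<open>Smoothness of the partial sum is proved together with the formula because the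
  Leibniz-type rules, here \<open>tangent_add\<close>, hold only for functions smooth near
  \<open>p\<close>.\<close>

lemma tangent_sum_fun:
  assumes v: "v \<in> tangent_space M p" and I: "finite I" and f: "\<And>i. i \<in> I \<Longrightarrow> smooth_near M p (f i)"
  shows "smooth_near M p (\<lambda>q. \<Sum>i\<in>I. f i q) \<and> v (\<lambda>q. \<Sum>i\<in>I. f i q) = (\<Sum>i\<in>I. v (f i))"
  using I f
proof (induction I rule: finite_induct)
  case empty
  have "p \<in> topspace (mtop M)" by (rule tangent_in_topspace[OF v])
  then show ?case by (simp add: tangent_const[OF v] smooth_near_const)
next
  case (insert i I)
  then show ?case by (simp add: tangent_add[OF v] smooth_near_add)
qed

text \<open>The chain rule in a chart, with \<open>has_derivative_det\<close> as outer derivative.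
  It is applied to the Gram matrix and to the component matrix of a frame.\<close>

lemma tangent_det:
  fixes A :: "'a \<Rightarrow> real^'m^'m"
  assumes v: "v \<in> tangent_space M p" and U: "p \<in> U" "\<And>i j. smooth_fun M U (\<lambda>p. A p $ i $ j)"
  shows "v (\<lambda>q. det (A q)) = det_derivative (A p) (\<chi> i j. v (\<lambda>q. A q $ i $ j))"
proof -
  obtain c w where c: "c \<in> atlas M" "p \<in> fst c" and vw: "v = dir_deriv M c p w"
    using v unfolding tangent_space_def by blast
  note der = smooth_near_has_derivative[OF c] and vf = dir_deriv_eq[of p _ c _ w, folded vw]
  let ?A' = "\<lambda>w. \<chi> i j. frechet_derivative ((\<lambda>q. A q $ i $ j) \<circ> chart_inv c) (at (snd c p)) w"
  have n: "smooth_near M p (\<lambda>q. A q $ i $ j)" for i j using U smooth_nearI by blast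
  have comp: "((\<lambda>y. (A \<circ> chart_inv c) y $ i $ j) has_derivative (\<lambda>w. ?A' w $ i $ j)) (at (snd c p))" for i j
    using der[OF n[of i j]] by (simp add: o_def)
  have "((A \<circ> chart_inv c) has_derivative ?A') (at (snd c p))"
    by (rule has_derivative_vecI, rule has_derivative_vecI, rule comp)
  from diff_chain_at[OF this has_derivative_det]
  have "((\<lambda>q. det (A q)) \<circ> chart_inv c has_derivative (\<lambda>w. det_derivative (A p) (?A' w))) (at (snd c p))"
    using c by (simp add: o_def)
  moreover have "smooth_near M p (\<lambda>q. det (A q))"
    using smooth_nearI[OF smooth_fun_det[of U A] U(1)] U(2) smooth_fun_open by blast
  ultimately have "v (\<lambda>q. det (A q)) = det_derivative (A p) (?A' w)"
    by (rule vf[rotated])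
  moreover have "v (\<lambda>q. A q $ i $ j) = ?A' w $ i $ j" for i j
    using vf[OF n der[OF n]] by simp
  then have "?A' w = (\<chi> i j. v (\<lambda>q. A q $ i $ j))" by (simp add: vec_eq_iff)
  ultimately show ?thesis by (simp only:)
qed

section \<open>Vector fields\<close>

lemma vector_field_open: "vector_field M U X \<Longrightarrow> openin (mtop M) U"
  unfolding vector_field_def by blast

lemma vector_field_tangent: "vector_field M U X \<Longrightarrow> p \<in> U \<Longrightarrow> X p \<in> tangent_space M p"
  unfolding vector_field_def by blast

lemma vector_field_smooth:
  assumes X: "vector_field M U X" and f: "smooth_fun M V f"
  shows "smooth_fun M (U \<inter> V) (\<lambda>p. X p f)"
proof -
  have "smooth_fun M (U \<inter> V) f"
    by (rule smooth_fun_subset[OF f]) (use vector_field_open[OF X] smooth_fun_open[OF f] in auto)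
  then show ?thesis using X unfolding vector_field_def by blast
qed

lemma vector_field_subset:
  "vector_field M U X \<Longrightarrow> openin (mtop M) V \<Longrightarrow> V \<subseteq> U \<Longrightarrow> vector_field M V X"
  unfolding vector_field_def by (meson order_trans subsetD)

lemma coord_field_smooth:
  assumes c: "c \<in> atlas M" and f: "smooth_fun M V f"
  shows "smooth_fun M (fst c \<inter> V) (\<lambda>p. coord_field M c j p f)"
proof (rule smooth_fun_chartI[OF c])
  show o: "openin (mtop M) (fst c \<inter> V)" using chart_open[OF c] smooth_fun_open[OF f] by blast
  have S: "open (snd c ` (fst c \<inter> V))" using open_chart_image[OF c smooth_fun_open[OF f]] .
  show "smooth_on ((\<lambda>p. coord_field M c j p f) \<circ> chart_inv c) (snd c ` (fst c \<inter> V))"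
    by (rule smooth_on_cong[OF S _ smooth_on_frechet[OF smooth_fun_chartD[OF c f], of "axis j 1"]])
      (use c smooth_nearI[OF f] in \<open>auto simp: coord_field_def dir_deriv_def\<close>)
qed auto

lemma vector_field_coord:
  assumes "c \<in> atlas M"
  shows "vector_field M (fst c) (coord_field M c i)"
  unfolding vector_field_def
  using chart_open[OF assms] coord_field_tangent[OF assms] coord_field_smooth[OF assms]
  by (metis Int_absorb1)

text \<open>By \<open>tangent_expand\<close>, the action on any smooth function is a combination of
  its partial derivatives with the components as coefficients, so it is enough that the components
  are smooth near each point.\<close>

lemma vector_fieldI:
  assumes U: "openin (mtop M) U" and T: "\<And>p. p \<in> U \<Longrightarrow> X p \<in> tangent_space M p"
    and S: "\<And>p. p \<in> U \<Longrightarrow> \<exists>c\<in>atlas M. \<exists>V. p \<in> V \<and> V \<subseteq> fst c \<and> (\<forall>j. smooth_fun M V (\<lambda>q. X q (coord c j)))"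
  shows "vector_field M U X"
  unfolding vector_field_def
proof (intro conjI ballI allI impI U T)
  fix V f assume "V \<subseteq> U \<and> smooth_fun M V f"
  then have V: "V \<subseteq> U" and f: "smooth_fun M V f" by auto
  note oV = smooth_fun_open[OF f]
  show "smooth_fun M V (\<lambda>p. X p f)"
  proof (rule smooth_fun_local[OF oV])
    fix p assume p: "p \<in> V"
    with V obtain c W where c: "c \<in> atlas M" and W: "p \<in> W" "W \<subseteq> fst c"
      "\<And>j. smooth_fun M W (\<lambda>q. X q (coord c j))" using S by (meson subsetD)
    have o: "openin (mtop M) (V \<inter> W)" using oV W(3) smooth_fun_open by blast
    have "smooth_fun M (fst c \<inter> V) (\<lambda>q. coord_field M c j q f)" for j
      using coord_field_smooth[OF c f] .
    then have "smooth_fun M (V \<inter> W) (\<lambda>q. coord_field M c j q f)" for j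
      by (rule smooth_fun_subset[OF _ o]) (use W in auto)
    moreover have "smooth_fun M (V \<inter> W) (\<lambda>q. X q (coord c j))" for j
      by (rule smooth_fun_subset[OF W(3) o]) auto
    ultimately have "smooth_fun M (V \<inter> W) (\<lambda>q. \<Sum>j\<in>UNIV. X q (coord c j) * coord_field M c j q f)"
      by (intro smooth_fun_sum smooth_fun_mult o)
    then have "smooth_fun M (V \<inter> W) (\<lambda>q. X q f)"
    proof (rule smooth_fun_cong)
      fix q assume "q \<in> V \<inter> W"
      then show "(\<Sum>j\<in>UNIV. X q (coord c j) * coord_field M c j q f) = X q f"
        using tangent_expand[OF T _ , of q c f] c V W(2) by (metis IntD1 IntD2 subsetD)
    qed
    then show "\<exists>W. p \<in> W \<and> smooth_fun M W (\<lambda>q. X q f)" using p W by blast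
  qed
qed

text \<open>The combination has the shape used in the axioms of \<open>connection\<close>. Finite
  sums and differences are reduced to it.\<close>

lemma vector_field_lincomb:
  assumes a: "smooth_fun M U a" and X: "vector_field M U X" and Y: "vector_field M U Y"
  shows "vector_field M U (\<lambda>q f. a q * X q f + Y q f)"
  unfolding vector_field_def
proof (intro conjI ballI allI impI smooth_fun_open[OF a])
  fix p assume p: "p \<in> U"
  show "(\<lambda>f. a p * X p f + Y p f) \<in> tangent_space M p"
    using tangent_lincomb[OF vector_field_tangent[OF X p] vector_field_tangent[OF Y p], of "a p" 1]
    by simp
next
  fix V f assume V: "V \<subseteq> U \<and> smooth_fun M V f"
  then have "smooth_fun M V (\<lambda>p. X p f)" "smooth_fun M V (\<lambda>p. Y p f)"
    using X Y unfolding vector_field_def by blast+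
  then show "smooth_fun M V (\<lambda>p. a p * X p f + Y p f)"
    using smooth_fun_subset[OF a _ ] V smooth_fun_open by (intro smooth_fun_add smooth_fun_mult) blast+
qed

lemma vector_field_zero: "openin (mtop M) U \<Longrightarrow> vector_field M U (\<lambda>_ _. 0)"
  unfolding vector_field_def using tangent_zero smooth_fun_const smooth_fun_open
  by (metis openin_subset subsetD)

lemma vector_field_sum:
  assumes "openin (mtop M) U" "\<And>i. i \<in> I \<Longrightarrow> smooth_fun M U (a i)" "\<And>i. i \<in> I \<Longrightarrow> vector_field M U (X i)"
  shows "vector_field M U (\<lambda>q f. \<Sum>i\<in>I. a i q * X i q f)"
  using assms(2,3)
  by (induction I rule: infinite_finite_induct)
    (simp_all add: vector_field_zero assms(1) vector_field_lincomb)

text \<open>The coefficients 2 and 1 serve \<open>dual_connection\<close>, the coefficients 1 and 1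
  serve \<open>bracket\<close>, and \<open>b = 0\<close> gives the multiple -2 of
  \<open>sharp\<close>.\<close>

lemma vector_field_cmult_diff:
  assumes X: "vector_field M U X" and Y: "vector_field M U Y"
  shows "vector_field M U (\<lambda>q f. a * X q f - b * Y q f)"
proof -
  note o = vector_field_open[OF X]
  have "vector_field M U (\<lambda>q f. (- b) * Y q f + 0)"
    by (rule vector_field_lincomb[OF smooth_fun_const[OF o] Y vector_field_zero[OF o]])
  from vector_field_lincomb[OF smooth_fun_const[OF o, of a] X this] show ?thesis by simp
qed

lemma coord_expansion:
  assumes "c \<in> atlas M" "vector_field M U X" "U \<subseteq> fst c" "p \<in> U"
  shows "X p = (\<lambda>f. \<Sum>i\<in>UNIV. X p (coord c i) * coord_field M c i p f)"
  using tangent_expand[OF vector_field_tangent[OF assms(2,4)] assms(1)] assms(3,4) by auto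

lemma vector_field_coord_smooth:
  assumes "c \<in> atlas M" "vector_field M U X" "U \<subseteq> fst c"
  shows "smooth_fun M U (\<lambda>p. X p (coord c i))"
  using vector_field_smooth[OF assms(2) smooth_fun_coord[OF assms(1)]] assms(3)
  by (simp add: Int_absorb2)

lemma vector_field_cong:
  assumes X: "vector_field M U X" and eq: "\<And>p. p \<in> U \<Longrightarrow> X p = Y p"
  shows "vector_field M U Y"
  unfolding vector_field_def
proof (intro conjI ballI allI impI)
  show "openin (mtop M) U" using vector_field_open[OF X] .
  show "Y p \<in> tangent_space M p" if "p \<in> U" for p
    using vector_field_tangent[OF X that] eq[OF that] by simp
  fix V f assume V: "V \<subseteq> U \<and> smooth_fun M V f"
  then have "smooth_fun M V (\<lambda>p. X p f)" using X unfolding vector_field_def by blast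
  then show "smooth_fun M V (\<lambda>p. Y p f)" by (rule smooth_fun_cong) (use V eq in auto)
qed

section \<open>Connections\<close>

lemma connection_vector_field:
  assumes "connection M D" "vector_field M U X" "vector_field M U Y"
  shows "vector_field M U (D X Y)"
proof -
  have "\<forall>U X Y. vector_field M U X \<and> vector_field M U Y \<longrightarrow> vector_field M U (D X Y)"
    using assms(1) unfolding connection_def by (elim conjE)
  with assms(2,3) show ?thesis by blast
qed

lemma connection_cong:
  assumes "connection M D" "vector_field M U X" "vector_field M U Y"
    "\<And>p. p \<in> U \<Longrightarrow> X p = X' p" "\<And>p. p \<in> U \<Longrightarrow> Y p = Y' p" "p \<in> U"
  shows "D X Y p = D X' Y' p"
proof -
  have *: "\<forall>U X X' Y Y'. vector_field M U X \<and> vector_field M U X' \<and>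
        vector_field M U Y \<and> vector_field M U Y' \<and>
        (\<forall>p\<in>U. X p = X' p \<and> Y p = Y' p) \<longrightarrow> (\<forall>p\<in>U. D X Y p = D X' Y' p)"
    using assms(1) unfolding connection_def by (elim conjE)
  have "vector_field M U X'" "vector_field M U Y'"
    using vector_field_cong[OF assms(2,4)] vector_field_cong[OF assms(3,5)] by auto
  with * assms(2-6) show ?thesis by blast
qed

lemma connection_left:
  assumes "connection M D" "smooth_fun M U a" "vector_field M U X" "vector_field M U X'"
    "vector_field M U Y" "p \<in> U"
  shows "D (\<lambda>q f. a q * X q f + X' q f) Y p f = a p * D X Y p f + D X' Y p f"
proof -
  have "\<forall>U a X X' Y. smooth_fun M U a \<and> vector_field M U X \<and> vector_field M U X' \<and>
        vector_field M U Y \<longrightarrow>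
        (\<forall>p\<in>U. D (\<lambda>q f. a q * X q f + X' q f) Y p = (\<lambda>f. a p * D X Y p f + D X' Y p f))"
    using assms(1) unfolding connection_def by (elim conjE)
  with assms(2-6) have "D (\<lambda>q f. a q * X q f + X' q f) Y p = (\<lambda>f. a p * D X Y p f + D X' Y p f)"
    by blast
  then show ?thesis by (rule fun_cong)
qed

lemma connection_right:
  assumes "connection M D" "smooth_fun M U a" "vector_field M U X" "vector_field M U Y"
    "vector_field M U Y'" "p \<in> U"
  shows "D X (\<lambda>q f. a q * Y q f + Y' q f) p f = X p a * Y p f + a p * D X Y p f + D X Y' p f"
proof -
  have "\<forall>U a X Y Y'. smooth_fun M U a \<and> vector_field M U X \<and> vector_field M U Y \<and>
        vector_field M U Y' \<longrightarrow>
        (\<forall>p\<in>U. D X (\<lambda>q f. a q * Y q f + Y' q f) p =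
           (\<lambda>f. X p a * Y p f + a p * D X Y p f + D X Y' p f))"
    using assms(1) unfolding connection_def by (elim conjE)
  with assms(2-6) have "D X (\<lambda>q f. a q * Y q f + Y' q f) p =
      (\<lambda>f. X p a * Y p f + a p * D X Y p f + D X Y' p f)"
    by blast
  then show ?thesis by (rule fun_cong)
qed

lemma connection_sum_left:
  assumes D: "connection M D" and I: "finite I" and a: "\<And>i. i \<in> I \<Longrightarrow> smooth_fun M U (a i)"
    and X: "\<And>i. i \<in> I \<Longrightarrow> vector_field M U (X i)" and Y: "vector_field M U Y" and p: "p \<in> U"
  shows "D (\<lambda>q f. \<Sum>i\<in>I. a i q * X i q f) Y p f = (\<Sum>i\<in>I. a i p * D (X i) Y p f)"
  using I a X
proof (induction I rule: finite_induct)
  case empty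
  note o = vector_field_open[OF Y]
  note z = vector_field_zero[OF o]
  \<comment> \<open>With coefficient 1 and both fields zero, the axiom says that the value of
    \<open>D\<close> at the zero field equals twice itself, hence vanishes.\<close>
  from connection_left[OF D smooth_fun_const[OF o, of 1] z z Y p, of f] show ?case by simp
next
  case (insert i I)
  have "vector_field M U (\<lambda>q f. \<Sum>i\<in>I. a i q * X i q f)"
    using insert.prems by (intro vector_field_sum vector_field_open[OF Y]) auto
  from connection_left[OF D _ _ this Y p, of "a i" "X i" f] insert show ?case by simp
qed

lemma connection_sum_right:
  assumes D: "connection M D" and I: "finite I" and a: "\<And>i. i \<in> I \<Longrightarrow> smooth_fun M U (a i)"
    and Y: "\<And>i. i \<in> I \<Longrightarrow> vector_field M U (Y i)" and X: "vector_field M U X" and p: "p \<in> U"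
  shows "D X (\<lambda>q f. \<Sum>i\<in>I. a i q * Y i q f) p f =
    (\<Sum>i\<in>I. X p (a i) * Y i p f + a i p * D X (Y i) p f)"
  using I a Y
proof (induction I rule: finite_induct)
  case empty
  note o = vector_field_open[OF X]
  note z = vector_field_zero[OF o]
  from connection_right[OF D smooth_fun_const[OF o, of 1] X z z p, of f] show ?case by simp
next
  case (insert i I)
  have "vector_field M U (\<lambda>q f. \<Sum>i\<in>I. a i q * Y i q f)"
    using insert.prems by (intro vector_field_sum vector_field_open[OF X]) auto
  from connection_right[OF D _ X _ this p, of "a i" "Y i" f] insert show ?case by simp
qed

text \<open>The difference of X(Y y) and (D_X Y) y is the Hessian of \<open>y\<close> with respect
  to \<open>D\<close>, a tensor in \<open>X\<close> and \<open>Y\<close>. It therefore vanishes as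
  soon as it vanishes on the coordinate fields of some chart, affine or not.\<close>

lemma connection_hessian_zero:
  assumes D: "connection M D" and c: "c \<in> atlas M" and U: "U \<subseteq> fst c" and y: "smooth_fun M U y"
    and h: "\<And>p i j. p \<in> U \<Longrightarrow> D (coord_field M c i) (coord_field M c j) p y
        = coord_field M c i p (\<lambda>q. coord_field M c j q y)"
    and X: "vector_field M U X" and Y: "vector_field M U Y" and p: "p \<in> U"
  shows "D X Y p y = X p (\<lambda>q. Y q y)"
proof -
  note o = vector_field_open[OF X]
  define a where "a i q = X q (coord c i)" for i q
  define b where "b i q = Y q (coord c i)" for i q
  have a: "smooth_fun M U (a i)" and b: "smooth_fun M U (b i)" for i
    unfolding a_def b_def using vector_field_coord_smooth[OF c _ U] X Y by auto
  have cf: "vector_field M U (coord_field M c i)" for i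
    by (rule vector_field_subset[OF vector_field_coord[OF c] o U])
  have Xe: "X q = (\<lambda>f. \<Sum>i\<in>UNIV. a i q * coord_field M c i q f)" if "q \<in> U" for q
    unfolding a_def by (rule coord_expansion[OF c X U that])
  have Ye: "Y q = (\<lambda>f. \<Sum>i\<in>UNIV. b i q * coord_field M c i q f)" if "q \<in> U" for q
    unfolding b_def by (rule coord_expansion[OF c Y U that])
  have Yv: "vector_field M U (\<lambda>q f. \<Sum>i\<in>UNIV. b i q * coord_field M c i q f)"
    by (intro vector_field_sum o b cf)
  have "D X Y p y = D (\<lambda>q f. \<Sum>i\<in>UNIV. a i q * coord_field M c i q f)
      (\<lambda>q f. \<Sum>i\<in>UNIV. b i q * coord_field M c i q f) p y"
    using connection_cong[OF D X Y Xe Ye p] by simp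
  also have "\<dots> = (\<Sum>i\<in>UNIV. a i p * D (coord_field M c i)
      (\<lambda>q f. \<Sum>j\<in>UNIV. b j q * coord_field M c j q f) p y)"
    by (intro connection_sum_left[OF D _ _ _ Yv p] a cf) simp
  also have "\<dots> = (\<Sum>i\<in>UNIV. a i p * coord_field M c i p (\<lambda>q. Y q y))"
  proof (rule sum.cong[OF refl])
    fix i :: 'n
    have t: "coord_field M c i p \<in> tangent_space M p" using vector_field_tangent[OF cf p] .
    have yj: "smooth_fun M U (\<lambda>q. coord_field M c j q y)" for j
      using vector_field_smooth[OF cf y] by simp
    have n: "smooth_near M p (b j)" "smooth_near M p (\<lambda>q. coord_field M c j q y)" for j
      using smooth_nearI[OF b p] smooth_nearI[OF yj p] by auto
    have "coord_field M c i p (\<lambda>q. Y q y)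
        = coord_field M c i p (\<lambda>q. \<Sum>j\<in>UNIV. b j q * coord_field M c j q y)"
      by (rule tangent_cong[OF t o p]) (simp add: Ye)
    also have "\<dots> = (\<Sum>j\<in>UNIV. coord_field M c i p (\<lambda>q. b j q * coord_field M c j q y))"
      using tangent_sum_fun[OF t, of UNIV "\<lambda>j q. b j q * coord_field M c j q y"] smooth_near_mult n
      by simp
    \<comment> \<open>The product rule for the derivation produces the same first-order term as the
      Leibniz rule of the connection; the remaining terms agree by \<open>h\<close>.\<close>
    also have "\<dots> = (\<Sum>j\<in>UNIV. coord_field M c i p (b j) * coord_field M c j p y +
        b j p * D (coord_field M c i) (coord_field M c j) p y)"
      by (rule sum.cong[OF refl]) (simp add: tangent_mult[OF t n] h[OF p])
    also have "\<dots> = D (coord_field M c i) (\<lambda>q f. \<Sum>j\<in>UNIV. b j q * coord_field M c j q f) p y"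
      by (rule connection_sum_right[OF D _ b cf cf p, symmetric]) simp
    finally show "a i p * D (coord_field M c i) (\<lambda>q f. \<Sum>j\<in>UNIV. b j q * coord_field M c j q f) p y
        = a i p * coord_field M c i p (\<lambda>q. Y q y)" by simp
  qed
  also have "\<dots> = X p (\<lambda>q. Y q y)" by (simp add: Xe[OF p])
  finally show ?thesis .
qed

text \<open>The coefficients 2 and -1 add up to 1, so the term X(a) Y of the Leibniz rule occurs
  exactly once. For the same reason the bracket occurs once in the torsion.\<close>

lemma dual_connection_connection:
  assumes N: "connection M N" and D: "connection M D"
  shows "connection M (dual_connection N D)"
  unfolding connection_def
proof (intro conjI allI impI ballI; (elim conjE)?)
  fix U X Y assume XY: "vector_field M U X" "vector_field M U Y"
  show "vector_field M U (dual_connection N D X Y)"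
    using vector_field_cmult_diff[OF connection_vector_field[OF N XY] connection_vector_field[OF D XY],
        of 2 1] by (simp add: dual_connection_def)
next
  fix U X X' Y Y' p assume "vector_field M U X" "vector_field M U Y"
    "\<forall>p\<in>U. X p = X' p \<and> Y p = Y' p" "p \<in> U"
  then show "dual_connection N D X Y p = dual_connection N D X' Y' p"
    unfolding dual_connection_def
    using connection_cong[OF N, of U X Y X' Y' p] connection_cong[OF D, of U X Y X' Y' p] by simp
next
  fix U a X X' Y p assume "smooth_fun M U a" "vector_field M U X" "vector_field M U X'"
    "vector_field M U Y" "p \<in> U"
  note * = this
  show "dual_connection N D (\<lambda>q f. a q * X q f + X' q f) Y p =
      (\<lambda>f. a p * dual_connection N D X Y p f + dual_connection N D X' Y p f)"
    unfolding dual_connection_def connection_left[OF N *] connection_left[OF D *]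
    by (simp add: algebra_simps)
next
  fix U a X Y Y' p assume "smooth_fun M U a" "vector_field M U X" "vector_field M U Y"
    "vector_field M U Y'" "p \<in> U"
  note * = this
  show "dual_connection N D X (\<lambda>q f. a q * Y q f + Y' q f) p =
      (\<lambda>f. X p a * Y p f + a p * dual_connection N D X Y p f + dual_connection N D X Y' p f)"
    unfolding dual_connection_def connection_right[OF N *] connection_right[OF D *]
    by (simp add: algebra_simps)
qed

lemma dual_connection_torsion_free:
  assumes "torsion_free M N" "torsion_free M D"
  shows "torsion_free M (dual_connection N D)"
  unfolding torsion_free_def
proof (intro allI impI ballI)
  fix U X Y p f assume XY: "vector_field M U X \<and> vector_field M U Y" and p: "p \<in> U"
  have "N X Y p f - N Y X p f - bracket M X Y p f = 0" "D X Y p f - D Y X p f - bracket M X Y p f = 0"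
    using assms XY p unfolding torsion_free_def by blast+
  then show "dual_connection N D X Y p f - dual_connection N D Y X p f - bracket M X Y p f = 0"
    by (simp add: dual_connection_def)
qed

lemma torsion_freeD:
  assumes "torsion_free M D" "vector_field M U X" "vector_field M U Y" "p \<in> U"
  shows "bracket M X Y p = (\<lambda>f. D X Y p f - D Y X p f)"
proof
  fix f
  have "D X Y p f - D Y X p f - bracket M X Y p f = 0"
    using assms unfolding torsion_free_def by blast
  then show "bracket M X Y p f = D X Y p f - D Y X p f" by simp
qed

section \<open>Linear forms on tangent spaces and construction of charts\<close>

lemma linear_on_tangent_lincomb:
  "linear_on_tangent M p l \<Longrightarrow> v \<in> tangent_space M p \<Longrightarrow> w \<in> tangent_space M p \<Longrightarrow>
    l (\<lambda>f. a * v f + b * w f) = a * l v + b * l w"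
  unfolding linear_on_tangent_def by blast

lemma linear_on_tangent_sum:
  assumes l: "linear_on_tangent M p l" and p: "p \<in> topspace (mtop M)" and I: "finite I"
    and v: "\<And>i. i \<in> I \<Longrightarrow> v i \<in> tangent_space M p"
  shows "l (\<lambda>f. \<Sum>i\<in>I. a i * v i f) = (\<Sum>i\<in>I. a i * l (v i))"
  using I v
proof (induction I rule: finite_induct)
  case empty
  show ?case using linear_on_tangent_lincomb[OF l tangent_zero[OF p] tangent_zero[OF p], of 0 0] by simp
next
  case (insert i I)
  have "(\<lambda>f. \<Sum>i\<in>I. a i * v i f) \<in> tangent_space M p"
    using insert.prems by (intro tangent_sum[OF p]) auto
  from linear_on_tangent_lincomb[OF l _ this, of "v i" "a i" 1] insert show ?case by simp
qed

lemma linear_on_tangent_diff: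
  assumes "linear_on_tangent M p l" "v \<in> tangent_space M p" "w \<in> tangent_space M p"
  shows "l (\<lambda>f. a * v f - b * w f) = a * l v - b * l w"
  using linear_on_tangent_lincomb[OF assms, of a "- b"] by simp

text \<open>New coordinates from functions with invertible Jacobian; the atlas contains the resulting
  chart because it is maximal.\<close>

lemma chart_from_functions:
  assumes c: "c \<in> atlas M" and p: "p \<in> fst c" and y: "\<And>k. smooth_fun M (fst c) (y k)"
    and det: "det (\<chi> i j. coord_field M c j p (y i)) \<noteq> 0"
  obtains d where "d \<in> atlas M" "p \<in> fst d" "fst d \<subseteq> fst c" "\<And>k. coord d k = y k"
proof -
  let ?U = "snd c ` fst c"
  define F where "F x = (\<chi> k. y k (chart_inv c x))" for x
  have oU: "open ?U" using open_chart_image'[OF c chart_open[OF c]] by simp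
  have F: "smooth_on F ?U"
    unfolding smooth_on_def
  proof (intro allI Ck_on_vec[OF oU])
    fix k i
    show "Ck_on k (\<lambda>x. F x $ i) ?U"
      using smooth_fun_chartD[OF c y[of i]] by (simp add: smooth_on_def F_def o_def)
  qed
  have xU: "snd c p \<in> ?U" using p by simp
  \<comment> \<open>The Jacobian matrix of \<open>F\<close>, the given functions read in the chart
    \<open>c\<close>, is the matrix in the hypothesis, so \<open>F\<close> is invertible after
    shrinking its domain to \<open>V\<close>.\<close>
  have "frechet_derivative F (at (snd c p)) (axis j 1) $ i = coord_field M c j p (y i)" for i j
  proof -
    have "((\<lambda>x. F x $ i) has_derivative (\<lambda>h. frechet_derivative F (at (snd c p)) h $ i)) (at (snd c p))"
      by (rule bounded_linear.has_derivative[OF bounded_linear_vec_nth smooth_on_has_derivative[OF F xU]])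
    then have "((y i \<circ> chart_inv c) has_derivative (\<lambda>h. frechet_derivative F (at (snd c p)) h $ i)) (at (snd c p))"
      by (simp add: F_def o_def)
    from dir_deriv_eq[OF smooth_nearI[OF y p] this] show ?thesis by (simp add: coord_field_def)
  qed
  then have "matrix (frechet_derivative F (at (snd c p))) = (\<chi> i j. coord_field M c j p (y i))"
    by (simp add: matrix_def)
  then obtain V W G where V: "open V" "V \<subseteq> ?U" "snd c p \<in> V" and W: "open W"
    and FG: "homeomorphism V W F G" and G: "smooth_on G W"
    using smooth_on_inverse_function[OF oU F xU] det by metis
  define d where "d = ({q \<in> fst c. snd c q \<in> V}, \<lambda>q. \<chi> k. y k q)"
  have d1: "fst d = {q \<in> fst c. snd c q \<in> V}" and d2: "snd d q = (\<chi> k. y k q)" for q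
    by (auto simp: d_def)
  have dF: "snd d q = F (snd c q)" if "q \<in> fst c" for q
    using that c by (simp add: d2 F_def)
  have od: "openin (mtop M) (fst d)" unfolding d1 by (rule open_chart_preimage[OF c V(1)])
  have img1: "snd c ` fst d = V" unfolding d1 using V(2) by auto
  have img: "snd d ` fst d = W"
  proof -
    have "snd d ` fst d = F ` (snd c ` fst d)"
      unfolding image_image by (rule image_cong) (auto simp: d1 dF)
    then show ?thesis using img1 FG unfolding homeomorphism_def by simp
  qed
  have chart: "is_chart (mtop M) d"
    unfolding is_chart_def img
  proof (intro conjI od W)
    have "homeomorphic_map (subtopology (mtop M) (fst c)) (top_of_set ?U) (snd c)"
      using is_chart[OF c] unfolding is_chart_def by blast
    moreover have "snd c ` (topspace (subtopology (mtop M) (fst c)) \<inter> fst d) = topspace (top_of_set ?U) \<inter> V"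
    proof -
      have "topspace (subtopology (mtop M) (fst c)) \<inter> fst d = fst d"
        using openin_subset[OF od] d1 by auto
      then show ?thesis using img1 V(2) by auto
    qed
    ultimately have "homeomorphic_map (subtopology (subtopology (mtop M) (fst c)) (fst d))
        (subtopology (top_of_set ?U) V) (snd c)"
      by (rule homeomorphic_map_subtopologies)
    moreover have "fst c \<inter> fst d = fst d" "?U \<inter> V = V" using V(2) d1 by auto
    ultimately have "homeomorphic_map (subtopology (mtop M) (fst d)) (top_of_set V) (snd c)"
      by (simp add: subtopology_subtopology)
    moreover have "homeomorphic_map (top_of_set V) (top_of_set W) F"
      using FG unfolding homeomorphic_map_maps homeomorphic_maps_def homeomorphism_def
      by (intro exI[of _ G]) (auto simp: continuous_map_in_subtopology)
    ultimately have "homeomorphic_map (subtopology (mtop M) (fst d)) (top_of_set W) (F \<circ> snd c)"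
      by (rule homeomorphic_map_compose)
    then show "homeomorphic_map (subtopology (mtop M) (fst d)) (top_of_set W) (snd d)"
      by (rule homeomorphic_map_eq) (auto simp: d1 dF)
  qed
  have dinv: "chart_inv d (snd d q) = q" if "q \<in> fst d" for q
    using chart_inv_image[OF chart that] .
  have GF: "G (snd d q) = snd c q" if "q \<in> fst d" for q
    using that FG dF unfolding homeomorphism_def by (simp add: d1)
  \<comment> \<open>On \<open>fst d\<close> the map \<open>snd c\<close> is \<open>G\<close> after
    \<open>snd d\<close>. So a transition map out of \<open>d\<close> is one out of \<open>c\<close>
    composed with \<open>G\<close>, and a transition map into \<open>d\<close> has as components the
    functions \<open>y i\<close> read in \<open>e\<close>.\<close>
  have "compatible d e" if e: "e \<in> atlas M" for e
    unfolding compatible_def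
  proof
    let ?S = "snd d ` (fst d \<inter> fst e)" and ?T = "snd c ` (fst c \<inter> fst e)"
    have oS: "open ?S" by (rule is_chart_open_image[OF chart chart_open[OF e]])
    have oT: "open ?T" by (rule open_chart_image[OF c chart_open[OF e]])
    have "?S \<subseteq> W" using img by auto
    then have GS: "smooth_on G ?S" using smooth_on_subset[OF G] by blast
    have "G ` ?S \<subseteq> ?T" using GF d1 by auto
    from smooth_on_compose[OF oS oT this GS transition_smooth[OF c e]]
    show "smooth_on (snd e \<circ> chart_inv d) ?S"
      by (rule smooth_on_cong[OF oS, rotated]) (use c dinv GF in \<open>auto simp: d1\<close>)
    let ?R = "snd e ` (fst d \<inter> fst e)"
    have oR: "open ?R" using open_chart_image[OF e od] by (simp add: Int_commute)
    show "smooth_on (snd d \<circ> chart_inv e) ?R"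
      unfolding smooth_on_def
    proof (intro allI Ck_on_vec[OF oR])
      fix k i
      have "Ck_on k (y i \<circ> chart_inv e) (snd e ` (fst e \<inter> fst c))"
        using smooth_fun_chartD[OF e y[of i]] by (simp add: smooth_on_def)
      then have "Ck_on k (y i \<circ> chart_inv e) ?R"
        by (rule Ck_on_subset) (use d1 in auto)
      then show "Ck_on k (\<lambda>x. (snd d \<circ> chart_inv e) x $ i) ?R"
        by (simp add: d2 o_def)
    qed
  qed
  then have "d \<in> atlas M" using mfd chart unfolding smooth_manifold_def by blast
  then show ?thesis using that[of d] p V(3) d1 d2 by auto
qed

end

section \<open>Riemannian metrics and Koszul forms\<close>

locale riemannian_mfd = smooth_mfd M for M :: "('a, 'n::finite) mfd" +
  fixes g :: "'a \<Rightarrow> 'a tvec \<Rightarrow> 'a tvec \<Rightarrow> real"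
  assumes metric: "riemannian_metric M g"
begin

lemma metric_linear: "v \<in> tangent_space M p \<Longrightarrow> linear_on_tangent M p (g p v)"
  using metric tangent_in_topspace unfolding riemannian_metric_def by blast

lemma metric_sym: "v \<in> tangent_space M p \<Longrightarrow> w \<in> tangent_space M p \<Longrightarrow> g p v w = g p w v"
  using metric tangent_in_topspace unfolding riemannian_metric_def by blast

lemma metric_pos: "v \<in> tangent_space M p \<Longrightarrow> v \<noteq> (\<lambda>_. 0) \<Longrightarrow> g p v v > 0"
  using metric tangent_in_topspace unfolding riemannian_metric_def by blast

lemma metric_smooth: "vector_field M U X \<Longrightarrow> vector_field M U Y \<Longrightarrow> smooth_fun M U (\<lambda>p. g p (X p) (Y p))"
  using metric unfolding riemannian_metric_def by blast

lemma metric_linear_left: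
  assumes w: "w \<in> tangent_space M p" shows "linear_on_tangent M p (\<lambda>v. g p v w)"
  unfolding linear_on_tangent_def
proof (intro ballI allI)
  fix u v a b assume uv: "u \<in> tangent_space M p" "v \<in> tangent_space M p"
  show "g p (\<lambda>f. a * u f + b * v f) w = a * g p u w + b * g p v w"
    using metric_sym[OF tangent_lincomb[OF uv] w] metric_sym[OF _ w] uv
      linear_on_tangent_lincomb[OF metric_linear[OF w] uv] by simp
qed

text \<open>Nondegeneracy from positivity: the difference of the two vectors is orthogonal to
  itself.\<close>

lemma metric_eqI:
  assumes v: "v \<in> tangent_space M p" "v' \<in> tangent_space M p"
    and eq: "\<And>w. w \<in> tangent_space M p \<Longrightarrow> g p v w = g p v' w"
  shows "v = v'"
proof -
  let ?u = "\<lambda>f. 1 * v f + (- 1) * v' f"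
  have u: "?u \<in> tangent_space M p" by (rule tangent_lincomb[OF v])
  have "g p ?u ?u = 0"
    using linear_on_tangent_lincomb[OF metric_linear_left[OF u] v, of 1 "-1"] eq[OF u] by simp
  then have "?u = (\<lambda>_. 0)" using metric_pos[OF u] by force
  then show ?thesis by (auto simp: fun_eq_iff)
qed

lemma metric_coord_eqI:
  assumes v: "v \<in> tangent_space M p" "v' \<in> tangent_space M p" and c: "c \<in> atlas M" "p \<in> fst c"
    and eq: "\<And>k. g p v (coord_field M c k p) = g p v' (coord_field M c k p)"
  shows "v = v'"
proof (rule metric_eqI[OF v])
  fix w assume w: "w \<in> tangent_space M p"
  have we: "w = (\<lambda>f. \<Sum>k\<in>UNIV. w (coord c k) * coord_field M c k p f)"
    by (rule ext, rule tangent_expand[OF w c])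
  have "g p u w = (\<Sum>k\<in>UNIV. w (coord c k) * g p u (coord_field M c k p))"
    if "u \<in> tangent_space M p" for u
    by (subst we) (rule linear_on_tangent_sum[OF metric_linear[OF that] topspace_chart[OF c]];
      simp add: coord_field_tangent[OF c])
  then show "g p v w = g p v' w" using v eq by simp
qed

section \<open>The Gram matrix and raising an index\<close>

definition gram :: "'a set \<times> ('a \<Rightarrow> real^'n) \<Rightarrow> 'a \<Rightarrow> real^'n^'n" where
  "gram c p = (\<chi> i j. g p (coord_field M c i p) (coord_field M c j p))"

lemma gram_smooth: "c \<in> atlas M \<Longrightarrow> smooth_fun M (fst c) (\<lambda>p. gram c p $ i $ j)"
  unfolding gram_def using metric_smooth[OF vector_field_coord vector_field_coord] by simp

text \<open>Lowering an index: the Gram matrix sends the components of a vector to those of its dual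
  form. Thus the components of \<open>sharp\<close> solve a linear system.\<close>

lemma gram_mult_vec:
  assumes c: "c \<in> atlas M" "p \<in> fst c"
  shows "(gram c p *v x) $ i = g p (\<lambda>f. \<Sum>j\<in>UNIV. x $ j * coord_field M c j p f) (coord_field M c i p)"
proof -
  note t = coord_field_tangent[OF c]
  have "g p (\<lambda>f. \<Sum>j\<in>UNIV. x $ j * coord_field M c j p f) (coord_field M c i p)
      = (\<Sum>j\<in>UNIV. x $ j * g p (coord_field M c j p) (coord_field M c i p))"
    by (rule linear_on_tangent_sum[OF metric_linear_left[OF t] topspace_chart[OF c]]) (simp_all add: t)
  also have "\<dots> = (gram c p *v x) $ i"
    unfolding gram_def matrix_vector_mult_def
    by (simp add: mult.commute metric_sym[OF t t, of _ i])
  finally show ?thesis by simp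
qed

text \<open>The quadratic form of the Gram matrix at \<open>x\<close> is the squared length of the
  vector with components \<open>x\<close>. Evaluating that vector on the coordinate functions
  returns \<open>x\<close>, so it is nonzero when \<open>x\<close> is.\<close>

lemma gram_det_pos:
  assumes c: "c \<in> atlas M" "p \<in> fst c"
  shows "det (gram c p) > 0"
proof (rule det_positive_definite)
  fix x :: "real^'n" assume x: "x \<noteq> 0"
  note t = coord_field_tangent[OF c]
  let ?v = "\<lambda>f. \<Sum>j\<in>UNIV. x $ j * coord_field M c j p f"
  have v: "?v \<in> tangent_space M p"
    by (rule tangent_sum[OF topspace_chart[OF c]]) (rule t)
  have "?v (coord c k) = x $ k" for k
    by (simp add: coord_field_coord[OF c] if_distrib[of "(*) _"] cong: if_cong)
  then have "?v \<noteq> (\<lambda>_. 0)" using x by (auto simp: vec_eq_iff fun_eq_iff) metis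
  then have "0 < g p ?v ?v" by (rule metric_pos[OF v])
  also have "g p ?v ?v = (\<Sum>i\<in>UNIV. x $ i * g p ?v (coord_field M c i p))"
    by (rule linear_on_tangent_sum[OF metric_linear[OF v] topspace_chart[OF c]]) (simp_all add: t)
  also have "\<dots> = x \<bullet> (gram c p *v x)"
    by (simp add: gram_mult_vec[OF c] inner_vec_def)
  finally show "x \<bullet> (gram c p *v x) > 0" .
qed

lemma volume_form_gram:
  "volume_form M g c p v = sqrt (det (gram c p)) * det (\<chi> i j. v i (coord c j))"
  unfolding volume_form_def gram_def ..

lemma sqrt_gram_smooth:
  assumes "c \<in> atlas M"
  shows "smooth_fun M (fst c) (\<lambda>p. sqrt (det (gram c p)))"
proof (rule smooth_fun_compose[OF smooth_fun_det[OF chart_open[OF assms]]])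
  show "smooth_on sqrt {0<..}" using Ck_on_sqrt unfolding smooth_on_def by blast
next
  show "smooth_fun M (fst c) (\<lambda>p. gram c p $ i $ j)" for i j by (rule gram_smooth[OF assms])
  show "(\<lambda>p. det (gram c p)) ` fst c \<subseteq> {0<..}" using gram_det_pos[OF assms] by blast
qed simp

text \<open>Since \<open>sharp\<close> is a definite description, existence and uniqueness must be
  supplied: existence by solving the Gram system, uniqueness by \<open>metric_eqI\<close>.\<close>

lemma sharp_tangent_and_eq:
  assumes p: "p \<in> topspace (mtop M)" and w: "linear_on_tangent M p (\<omega> p)"
  shows "sharp M g \<omega> p \<in> tangent_space M p \<and> (\<forall>v\<in>tangent_space M p. g p (sharp M g \<omega> p) v = \<omega> p v)"
proof -
  obtain c where c: "c \<in> atlas M" "p \<in> fst c" using chart_covers[OF p] .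
  note t = coord_field_tangent[OF c]
  have "det (gram c p) \<noteq> 0" using gram_det_pos[OF c] by simp
  then obtain x where x: "gram c p *v x = (\<chi> i. \<omega> p (coord_field M c i p))"
    using cramer by blast
  let ?v = "\<lambda>f. \<Sum>j\<in>UNIV. x $ j * coord_field M c j p f"
  have v: "?v \<in> tangent_space M p"
    by (rule tangent_sum[OF p]) (rule t)
  have "g p ?v u = \<omega> p u" if u: "u \<in> tangent_space M p" for u
  proof -
    have ue: "u = (\<lambda>f. \<Sum>k\<in>UNIV. u (coord c k) * coord_field M c k p f)"
      by (rule ext, rule tangent_expand[OF u c])
    have "g p ?v u = (\<Sum>k\<in>UNIV. u (coord c k) * g p ?v (coord_field M c k p))"
      by (subst ue) (rule linear_on_tangent_sum[OF metric_linear[OF v] p]; simp add: t)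
    also have "\<dots> = (\<Sum>k\<in>UNIV. u (coord c k) * \<omega> p (coord_field M c k p))"
      using x by (simp add: gram_mult_vec[OF c, symmetric])
    also have "\<dots> = \<omega> p u"
      by (subst (2) ue) (rule linear_on_tangent_sum[OF w p, symmetric]; simp add: t)
    finally show ?thesis .
  qed
  then have "\<exists>!w. w \<in> tangent_space M p \<and> (\<forall>v\<in>tangent_space M p. g p w v = \<omega> p v)"
    using v metric_eqI by (intro ex1I[of _ ?v]) auto
  from theI'[OF this] show ?thesis unfolding sharp_def .
qed

lemma sharp_vector_field:
  assumes w: "one_form M \<omega>"
  shows "vector_field M (topspace (mtop M)) (sharp M g \<omega>)"
proof (rule vector_fieldI)
  show "openin (mtop M) (topspace (mtop M))" by simp
  have l: "linear_on_tangent M p (\<omega> p)" if "p \<in> topspace (mtop M)" for p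
    using w that unfolding one_form_def by blast
  show T: "sharp M g \<omega> p \<in> tangent_space M p" if "p \<in> topspace (mtop M)" for p
    using sharp_tangent_and_eq[of p \<omega>, OF that l[OF that]] by blast
  fix p assume "p \<in> topspace (mtop M)"
  then obtain c where c: "c \<in> atlas M" "p \<in> fst c" using chart_covers by blast
  have "smooth_fun M (fst c) (\<lambda>q. (\<chi> j. sharp M g \<omega> q (coord c j)) $ i)" for i
  proof (rule smooth_fun_cramer[OF chart_open[OF c(1)] gram_smooth[OF c(1)],
        where b = "\<lambda>q. \<chi> k. \<omega> q (coord_field M c k q)"])
    show "smooth_fun M (fst c) (\<lambda>q. (\<chi> k. \<omega> q (coord_field M c k q)) $ i)" for i
      using w vector_field_coord[OF c(1)] unfolding one_form_def by simp
    fix q assume q: "q \<in> fst c"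
    note qt = topspace_chart[OF c(1) q]
    show "det (gram c q) \<noteq> 0" using gram_det_pos[OF c(1) q] by simp
    have "(\<lambda>f. \<Sum>j\<in>UNIV. sharp M g \<omega> q (coord c j) * coord_field M c j q f) = sharp M g \<omega> q"
      by (rule ext, rule tangent_expand[OF T[OF qt] c(1) q, symmetric])
    then show "gram c q *v (\<chi> j. sharp M g \<omega> q (coord c j)) = (\<chi> k. \<omega> q (coord_field M c k q))"
      using sharp_tangent_and_eq[of q \<omega>, OF qt l[OF qt]] coord_field_tangent[OF c(1) q]
      by (simp add: vec_eq_iff gram_mult_vec[OF c(1) q])
  qed
  then show "\<exists>c\<in>atlas M. \<exists>V. p \<in> V \<and> V \<subseteq> fst c \<and> (\<forall>j. smooth_fun M V (\<lambda>q. sharp M g \<omega> q (coord c j)))"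
    using c by auto
qed

text \<open>The arguments of the volume form are the rows of a matrix, so replacing them one at a
  time gives \<open>det_derivative\<close>. The connection now enters only through a linear
  function, which is what \<open>first_koszul_form_dual\<close> exploits.\<close>

lemma cov_top_form_volume_form:
  "cov_top_form D (volume_form M g c) X E p =
    X p (\<lambda>q. sqrt (det (gram c q)) * det (\<chi> i j. E i q (coord c j)))
    - sqrt (det (gram c p)) * det_derivative (\<chi> i j. E i p (coord c j)) (\<chi> i j. D X (E i) p (coord c j))"
proof -
  have "(\<chi> k j. ((\<lambda>j. E j p)(i := D X (E i) p)) k (coord c j))
    = (\<chi> k. if k = i then (\<chi> i j. D X (E i) p (coord c j)) $ i else (\<chi> i j. E i p (coord c j)) $ k)" for i
    by (simp add: vec_eq_iff)
  then show ?thesis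
    unfolding cov_top_form_def volume_form_gram det_derivative_def by (simp only: sum_distrib_left)
qed

lemma levi_civita_metric:
  assumes N: "levi_civita M g N" and XYZ: "vector_field M U X" "vector_field M U Y" "vector_field M U Z"
    and p: "p \<in> U"
  shows "X p (\<lambda>q. g q (Y q) (Z q)) = g p (N X Y p) (Z p) + g p (Y p) (N X Z p)"
  using assms unfolding levi_civita_def by blast

text \<open>Metric compatibility makes the derivative of the Gram matrix
  \<open>\<Gamma> ** gram c p\<close> plus its transpose, so by Jacobi's formula the density \<rho>
  has derivative \<open>trace \<Gamma> * \<rho> p\<close>. The components \<open>e\<close> of the
  frame satisfy N_X E = X e + e \<Gamma>, which contributes the same trace with the opposite
  sign.\<close>

lemma levi_civita_volume_parallel:
  assumes N: "levi_civita M g N" and c: "c \<in> atlas M" and U: "U \<subseteq> fst c"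
    and X: "vector_field M U X" and E: "\<And>i. vector_field M U (E i)" and p: "p \<in> U"
  shows "cov_top_form N (volume_form M g c) X E p = 0"
proof -
  have conn: "connection M N" using N unfolding levi_civita_def by blast
  note o = vector_field_open[OF X]
  have pc: "p \<in> fst c" using p U by blast
  have cf: "vector_field M U (coord_field M c i)" for i
    by (rule vector_field_subset[OF vector_field_coord[OF c] o U])
  note t = coord_field_tangent[OF c pc]
  define v where "v = X p"
  have v: "v \<in> tangent_space M p" unfolding v_def by (rule vector_field_tangent[OF X p])
  \<comment> \<open>The connection matrix of \<open>N\<close> along \<open>X\<close>: row
    \<open>i\<close> holds the components of the derivative of the i-th coordinate field. It acts on
    the Gram matrix from the left and on \<open>e\<close> from the right.\<close>
  define \<Gamma> where "\<Gamma> = (\<chi> i j. N X (coord_field M c i) p (coord c j))"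
  define e where "e q = (\<chi> i j. E i q (coord c j))" for q
  define \<rho> where "\<rho> q = sqrt (det (gram c q))" for q
  have Nt: "N X (coord_field M c i) p \<in> tangent_space M p" for i
    by (rule vector_field_tangent[OF connection_vector_field[OF conn X cf] p])
  have Ne: "N X (coord_field M c i) p = (\<lambda>f. \<Sum>k\<in>UNIV. \<Gamma> $ i $ k * coord_field M c k p f)" for i
    unfolding \<Gamma>_def vec_lambda_beta by (rule ext, rule tangent_expand[OF Nt c pc])
  have Ng: "g p (N X (coord_field M c i) p) (coord_field M c j p) = (\<Gamma> ** gram c p) $ i $ j" for i j
  proof -
    have "g p (N X (coord_field M c i) p) (coord_field M c j p)
        = (\<Sum>k\<in>UNIV. \<Gamma> $ i $ k * g p (coord_field M c k p) (coord_field M c j p))"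
      unfolding Ne
      by (rule linear_on_tangent_sum[OF metric_linear_left[OF t] topspace_chart[OF c pc]]) (simp_all add: t)
    then show ?thesis by (simp add: matrix_matrix_mult_def gram_def)
  qed
  have gsym: "transpose (gram c p) = gram c p"
    using metric_sym[OF t t] by (simp add: transpose_def gram_def vec_eq_iff)
  have "(\<chi> i j. v (\<lambda>q. gram c q $ i $ j)) = \<Gamma> ** gram c p + gram c p ** transpose \<Gamma>"
  proof -
    have "v (\<lambda>q. gram c q $ i $ j) = (\<Gamma> ** gram c p) $ i $ j + (\<Gamma> ** gram c p) $ j $ i" for i j
      using levi_civita_metric[OF N X cf cf p, of i j] Ng metric_sym[OF t Nt]
      by (simp add: gram_def v_def)
    moreover have "gram c p ** transpose \<Gamma> = transpose (\<Gamma> ** gram c p)"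
      by (simp only: matrix_transpose_mul gsym)
    ultimately show ?thesis by (simp add: vec_eq_iff transpose_def)
  qed
  moreover have "v (\<lambda>q. det (gram c q)) = det_derivative (gram c p) (\<chi> i j. v (\<lambda>q. gram c q $ i $ j))"
    by (rule tangent_det[OF v pc gram_smooth[OF c]])
  ultimately have "v (\<lambda>q. det (gram c q)) = 2 * (trace \<Gamma> * det (gram c p))"
    by (simp add: linear_add[OF linear_det_derivative] det_derivative_left det_derivative_right)
       (simp add: trace_def transpose_def)
  moreover have \<rho>n: "smooth_near M p \<rho>"
    using smooth_nearI[OF sqrt_gram_smooth[OF c] pc] unfolding \<rho>_def .
  \<comment> \<open>The derivative of the square root is found from the product rule for its square,
    divided by the nonzero \<open>\<rho> p\<close>.\<close>
  have "v (\<lambda>q. det (gram c q)) = v (\<lambda>q. \<rho> q * \<rho> q)"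
    by (rule tangent_cong[OF v chart_open[OF c] pc])
      (use gram_det_pos[OF c] in \<open>simp add: \<rho>_def less_imp_le\<close>)
  moreover have "v (\<lambda>q. \<rho> q * \<rho> q) = 2 * (\<rho> p * v \<rho>)"
    using tangent_mult[OF v \<rho>n \<rho>n] by simp
  moreover have "det (gram c p) = \<rho> p * \<rho> p" "\<rho> p \<noteq> 0"
    using gram_det_pos[OF c pc] by (simp_all add: \<rho>_def)
  ultimately have v\<rho>: "v \<rho> = trace \<Gamma> * \<rho> p" by simp
  have es: "smooth_fun M U (\<lambda>q. e q $ i $ j)" for i j
    unfolding e_def using vector_field_coord_smooth[OF c E U] by simp
  have ve: "v (\<lambda>q. det (e q)) = det_derivative (e p) (\<chi> i j. v (\<lambda>q. e q $ i $ j))"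
    by (rule tangent_det[OF v p es])
  have "N X (E i) p (coord c j) = v (\<lambda>q. e q $ i $ j) + (e p ** \<Gamma>) $ i $ j" for i j
  proof -
    have "N X (E i) p (coord c j) = N X (\<lambda>q f. \<Sum>k\<in>UNIV. e q $ i $ k * coord_field M c k q f) p (coord c j)"
      using connection_cong[OF conn X E _ _ p, of X i "\<lambda>q f. \<Sum>k\<in>UNIV. e q $ i $ k * coord_field M c k q f"]
        coord_expansion[OF c E U] by (simp add: e_def)
    also have "\<dots> = (\<Sum>k\<in>UNIV. v (\<lambda>q. e q $ i $ k) * coord_field M c k p (coord c j) +
        e p $ i $ k * N X (coord_field M c k) p (coord c j))"
      unfolding v_def by (rule connection_sum_right[OF conn _ es cf X p]) simp
    also have "\<dots> = v (\<lambda>q. e q $ i $ j) + (e p ** \<Gamma>) $ i $ j"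
      by (simp add: coord_field_coord[OF c pc] matrix_matrix_mult_def \<Gamma>_def sum.distrib
          if_distrib[of "(*) _"] cong: if_cong)
    finally show ?thesis .
  qed
  then have "(\<chi> i j. N X (E i) p (coord c j)) = (\<chi> i j. v (\<lambda>q. e q $ i $ j)) + e p ** \<Gamma>"
    by (simp add: vec_eq_iff)
  then have "det_derivative (e p) (\<chi> i j. N X (E i) p (coord c j))
      = v (\<lambda>q. det (e q)) + trace \<Gamma> * det (e p)"
    by (simp add: linear_add[OF linear_det_derivative] det_derivative_right ve)
  moreover have "smooth_near M p (\<lambda>q. det (e q))"
    using smooth_nearI[OF smooth_fun_det[OF o es] p] .
  then have "v (\<lambda>q. \<rho> q * det (e q)) = \<rho> p * v (\<lambda>q. det (e q)) + v \<rho> * det (e p)"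
    by (rule tangent_mult[OF v \<rho>n])
  ultimately show ?thesis
    unfolding cov_top_form_volume_form e_def[symmetric] \<rho>_def[symmetric] v_def[symmetric] v\<rho>
    by (simp add: algebra_simps)
qed

text \<open>By linearity in the connection, and since 2 - 1 = 1 keeps the term with X, the
  derivative of the volume form for the dual connection is twice that for \<open>N\<close>, which is
  zero, minus that for \<open>D\<close>.\<close>

lemma first_koszul_form_dual:
  assumes N: "levi_civita M g N" and a: "first_koszul_form M D g \<alpha>"
  shows "first_koszul_form M (dual_connection N D) g (\<lambda>p v. - \<alpha> p v)"
  unfolding first_koszul_form_def
proof (intro conjI ballI allI impI; (elim conjE)?)
  have one: "one_form M \<alpha>" using a unfolding first_koszul_form_def by blast
  show "one_form M (\<lambda>p v. - \<alpha> p v)"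
    unfolding one_form_def
  proof (intro conjI ballI allI impI)
    fix p assume "p \<in> topspace (mtop M)"
    then have "linear_on_tangent M p (\<alpha> p)" using one unfolding one_form_def by blast
    then show "linear_on_tangent M p (\<lambda>v. - \<alpha> p v)"
      unfolding linear_on_tangent_def by simp
  next
    fix U X assume "vector_field M U X"
    then have "smooth_fun M U (\<lambda>p. \<alpha> p (X p))" using one unfolding one_form_def by blast
    from smooth_fun_cmult[OF this, of "-1"] show "smooth_fun M U (\<lambda>p. - \<alpha> p (X p))" by simp
  qed
  fix c U X p and E :: "'n \<Rightarrow> 'a vfield" assume c: "c \<in> atlas M" and U: "U \<subseteq> fst c" and X: "vector_field M U X"
    and E: "\<forall>i. vector_field M U (E i)" and p: "p \<in> U"
  have DE: "cov_top_form D (volume_form M g c) X E p = \<alpha> p (X p) * volume_form M g c p (\<lambda>i. E i p)"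
    using a c U X E p unfolding first_koszul_form_def by blast
  have NE: "cov_top_form N (volume_form M g c) X E p = 0"
    by (rule levi_civita_volume_parallel[OF N c U X _ p]) (use E in blast)
  let ?B = "\<lambda>D::'a vfield \<Rightarrow> 'a vfield \<Rightarrow> 'a vfield. \<chi> i j. D X (E i) p (coord c j)"
  have B: "?B (dual_connection N D) = 2 *\<^sub>R ?B N - ?B D"
    by (simp add: vec_eq_iff dual_connection_def)
  have "cov_top_form (dual_connection N D) (volume_form M g c) X E p
      = 2 * cov_top_form N (volume_form M g c) X E p - cov_top_form D (volume_form M g c) X E p"
    unfolding cov_top_form_volume_form B linear_diff[OF linear_det_derivative]
      linear_scale[OF linear_det_derivative]
    by (simp add: algebra_simps)
  then show "cov_top_form (dual_connection N D) (volume_form M g c) X E p =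
      - \<alpha> p (X p) * volume_form M g c p (\<lambda>i. E i p)"
    using DE NE by simp
qed

text \<open>Needed because \<open>hesse_einstein\<close> provides a Koszul form of its own, while
  the soliton field is built from a given one. The coordinate frame has nonzero volume, so the
  defining equation can be divided by it.\<close>

lemma first_koszul_form_unique:
  assumes a: "first_koszul_form M D g \<alpha>" and b: "first_koszul_form M D g \<beta>"
    and v: "v \<in> tangent_space M p"
  shows "\<alpha> p v = \<beta> p v"
proof -
  obtain c where c: "c \<in> atlas M" "p \<in> fst c" using tangent_topspace[OF v] .
  note o = chart_open[OF c(1)]
  \<comment> \<open>Constant components extend the single vector \<open>v\<close> to a smooth field
    on the chart domain.\<close>
  define X where "X = (\<lambda>q f. \<Sum>i\<in>UNIV. v (coord c i) * coord_field M c i q f)"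
  have X: "vector_field M (fst c) X"
    unfolding X_def by (intro vector_field_sum o smooth_fun_const vector_field_coord[OF c(1)])
  have Xp: "X p = v" unfolding X_def by (rule ext, rule tangent_expand[OF v c, symmetric])
  have E: "\<forall>i. vector_field M (fst c) (coord_field M c i)" using vector_field_coord[OF c(1)] by blast
  let ?V = "volume_form M g c p (\<lambda>i. coord_field M c i p)"
  have "cov_top_form D (volume_form M g c) X (coord_field M c) p = \<alpha> p (X p) * ?V"
    "cov_top_form D (volume_form M g c) X (coord_field M c) p = \<beta> p (X p) * ?V"
    using a b c X E unfolding first_koszul_form_def by blast+
  moreover have "?V \<noteq> 0"
  proof -
    have "(\<chi> i j. coord_field M c i p (coord c j)) = (mat 1 :: real^'n^'n)"
      by (simp add: vec_eq_iff mat_def coord_field_coord[OF c])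
    then show ?thesis using gram_det_pos[OF c] by (simp add: volume_form_gram)
  qed
  ultimately show ?thesis using Xp by simp
qed

end

section \<open>The dual Hessian structure\<close>

locale hessian_mfd = riemannian_mfd M g for M :: "('a, 'n::finite) mfd" and g +
  fixes D N :: "'a vfield \<Rightarrow> 'a vfield \<Rightarrow> 'a vfield"
  assumes hessian: "hessian_manifold M D g" and levi_civita: "levi_civita M g N"
begin

abbreviation D' where "D' \<equiv> dual_connection N D"

lemma conn_D: "connection M D" and tors_D: "torsion_free M D"
  using hessian unfolding hessian_manifold_def flat_connection_def by blast+

lemma conn_N: "connection M N" and tors_N: "torsion_free M N"
  using levi_civita unfolding levi_civita_def by blast+

lemmas conn_D' = dual_connection_connection[OF conn_N conn_D]
  and tors_D' = dual_connection_torsion_free[OF tors_N tors_D]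

text \<open>Torsion-freeness writes the bracket as D_X Y - D_Y X, so it inherits smoothness and
  tangency from the connection.\<close>

lemma bracket_vector_field:
  assumes "vector_field M U X" "vector_field M U Y"
  shows "vector_field M U (bracket M X Y)"
proof (rule vector_field_cong)
  show "vector_field M U (\<lambda>p f. 1 * D X Y p f - 1 * D Y X p f)"
    by (intro vector_field_cmult_diff connection_vector_field[OF conn_D] assms)
  show "(\<lambda>f. 1 * D X Y p f - 1 * D Y X p f) = bracket M X Y p" if "p \<in> U" for p
    using torsion_freeD[OF tors_D assms that] by simp
qed

text \<open>Torsion-freeness of \<open>D\<close> yields the symmetry of second derivatives, so Schwarz's theorem is not
  needed.\<close>

lemma affine_chart_commute:
  assumes c: "affine_chart M D c" and p: "p \<in> fst c"
  shows "bracket M (coord_field M c i) (coord_field M c j) p = (\<lambda>_. 0)"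
    and "smooth_near M p f \<Longrightarrow> coord_field M c i p (\<lambda>q. coord_field M c j q f)
        = coord_field M c j p (\<lambda>q. coord_field M c i q f)"
proof -
  have ca: "c \<in> atlas M" using c unfolding affine_chart_def by blast
  have "D (coord_field M c i) (coord_field M c j) p = (\<lambda>_. 0)" for i j
    using c p unfolding affine_chart_def by blast
  then show b: "bracket M (coord_field M c i) (coord_field M c j) p = (\<lambda>_. 0)"
    using torsion_freeD[OF tors_D vector_field_coord[OF ca] vector_field_coord[OF ca] p] by simp
  show "coord_field M c i p (\<lambda>q. coord_field M c j q f)
        = coord_field M c j p (\<lambda>q. coord_field M c i q f)" if "smooth_near M p f"
    using fun_cong[OF b, of f] that by (simp add: bracket_def)
qed

text \<open>The witness condition inside \<open>hessian_manifold\<close>, named so that a chart and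
  its potential can be fixed in a context.\<close>

definition potential :: "'a set \<times> ('a \<Rightarrow> real^'n) \<Rightarrow> ('a \<Rightarrow> real) \<Rightarrow> bool" where
  "potential c \<phi> \<longleftrightarrow> affine_chart M D c \<and> smooth_fun M (fst c) \<phi> \<and>
     (\<forall>q\<in>fst c. \<forall>i j. g q (coord_field M c i q) (coord_field M c j q) =
           coord_field M c i q (\<lambda>r. coord_field M c j r \<phi>))"

lemma potential_exists:
  assumes "p \<in> topspace (mtop M)"
  obtains c \<phi> where "potential c \<phi>" "p \<in> fst c"
  using hessian assms unfolding hessian_manifold_def potential_def by blast

section \<open>Dual coordinates and the Legendre transform in one affine chart\<close>

context
  fixes c \<phi> assumes pot: "potential c \<phi>"
begin

lemma affine: "affine_chart M D c"
  using pot unfolding potential_def by blast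

lemma chart: "c \<in> atlas M"
  using affine unfolding affine_chart_def by blast

definition dual_coord :: "'n \<Rightarrow> 'a \<Rightarrow> real" where
  "dual_coord k q = coord_field M c k q \<phi>"

lemma dual_coord_smooth: "smooth_fun M (fst c) (dual_coord k)"
  using coord_field_smooth[OF chart, of "fst c" \<phi> k] pot unfolding potential_def dual_coord_def[abs_def]
  by simp

lemma metric_coord_coord:
  "q \<in> fst c \<Longrightarrow> g q (coord_field M c i q) (coord_field M c j q) = coord_field M c i q (dual_coord j)"
  using pot unfolding potential_def dual_coord_def[abs_def] by blast

text \<open>The form dual to the k-th coordinate field is the differential of the k-th dual
  coordinate; by linearity it suffices to know this on coordinate fields. Hence the dual coordinates
  separate tangent vectors, as used in \<open>dual_coord_eqI\<close>.\<close>

lemma metric_coord_right: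
  assumes q: "q \<in> fst c" and v: "v \<in> tangent_space M q"
  shows "g q v (coord_field M c k q) = v (dual_coord k)"
proof -
  note t = coord_field_tangent[OF chart q]
  have "g q v (coord_field M c k q)
      = g q (\<lambda>f. \<Sum>i\<in>UNIV. v (coord c i) * coord_field M c i q f) (coord_field M c k q)"
    by (rule arg_cong[where f = "\<lambda>v. g q v _"], rule ext, rule tangent_expand[OF v chart q])
  also have "\<dots> = (\<Sum>i\<in>UNIV. v (coord c i) * g q (coord_field M c i q) (coord_field M c k q))"
    by (rule linear_on_tangent_sum[OF metric_linear_left[OF t] topspace_chart[OF chart q]])
      (simp_all add: t)
  also have "\<dots> = v (dual_coord k)"
    unfolding metric_coord_coord[OF q] by (rule tangent_expand[OF v chart q, symmetric])
  finally show ?thesis .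
qed

lemma dual_coord_eqI:
  assumes q: "q \<in> fst c" and v: "v \<in> tangent_space M q" "v' \<in> tangent_space M q"
    and eq: "\<And>k. v (dual_coord k) = v' (dual_coord k)"
  shows "v = v'"
  by (rule metric_coord_eqI[OF v chart q]) (simp add: metric_coord_right[OF q] v eq)

text \<open>Koszul's formula: in affine coordinates the third derivatives of the potential are symmetric,
  so the Christoffel symbols of \<open>N\<close> are half of them.\<close>

lemma dual_connection_coord:
  assumes p: "p \<in> fst c"
  shows "D' (coord_field M c i) (coord_field M c j) p (dual_coord k)
    = coord_field M c i p (\<lambda>q. coord_field M c j q (dual_coord k))"
proof -
  note vf = vector_field_coord[OF chart]
  note t = coord_field_tangent[OF chart p]
  define n where "n i j k = N (coord_field M c i) (coord_field M c j) p (dual_coord k)" for i j k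
  define h where "h i j k = coord_field M c i p (\<lambda>q. coord_field M c j q (dual_coord k))" for i j k
  have Nt: "N (coord_field M c i) (coord_field M c j) p \<in> tangent_space M p" for i j
    by (rule vector_field_tangent[OF connection_vector_field[OF conn_N vf vf] p])
  have n_sym: "n i j k = n j i k" for i j k
    using fun_cong[OF torsion_freeD[OF tors_N vf vf p, of i j], of "dual_coord k"]
      affine_chart_commute(1)[OF affine p, of i j] by (simp add: n_def)
  have h_sym: "h i j k = h j i k" for i j k
    unfolding h_def by (rule affine_chart_commute(2)[OF affine p smooth_nearI[OF dual_coord_smooth p]])
  have h_n: "h i j k = n i j k + n i k j" for i j k
  proof -
    have "h i j k = coord_field M c i p (\<lambda>q. g q (coord_field M c j q) (coord_field M c k q))"
      unfolding h_def by (rule tangent_cong[OF t chart_open[OF chart] p]) (simp add: metric_coord_coord)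
    also have "\<dots> = n i j k + g p (coord_field M c j p) (N (coord_field M c i) (coord_field M c k) p)"
      by (simp add: levi_civita_metric[OF levi_civita vf vf vf p] metric_coord_right[OF p Nt] n_def)
    also have "g p (coord_field M c j p) (N (coord_field M c i) (coord_field M c k) p) = n i k j"
      by (simp add: metric_sym[OF t Nt] metric_coord_right[OF p Nt] n_def)
    finally show ?thesis .
  qed
  \<comment> \<open>By \<open>h_n\<close>, \<open>h\<close> is symmetric in its last two indices,
    hence totally symmetric with \<open>h_sym\<close>. In \<open>h i j k + h j i k - h k i j\<close>
    everything but \<open>2 * n i j k\<close> cancels by \<open>n_sym\<close>.\<close>
  have "2 * n i j k = h i j k"
    using h_n[of i j k] h_n[of j i k] h_n[of k i j] h_sym[of i j k] n_sym[of i j k] n_sym[of i k j]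
      n_sym[of j k i] h_sym[of k i j] h_n[of i k j] by simp
  moreover have "D (coord_field M c i) (coord_field M c j) p = (\<lambda>_. 0)"
    using affine p unfolding affine_chart_def by blast
  ultimately show ?thesis by (simp add: dual_connection_def n_def h_def)
qed

text \<open>The dual coordinates have vanishing Hessian for \<open>D'\<close>, that is, they are
  affine functions. The preceding lemma shows it for coordinate fields, and tensoriality does the
  rest.\<close>

lemma dual_connection_dual_coord:
  assumes X: "vector_field M U X" "vector_field M U Y" and U: "U \<subseteq> fst c" and p: "p \<in> U"
  shows "D' X Y p (dual_coord k) = X p (\<lambda>q. Y q (dual_coord k))"
proof (rule connection_hessian_zero[OF conn_D' chart U _ _ X p])
  show "smooth_fun M U (dual_coord k)"
    by (rule smooth_fun_subset[OF dual_coord_smooth vector_field_open[OF X(1)] U])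
qed (use dual_connection_coord U in blast)

text \<open>On a dual coordinate the covariant derivatives become iterated derivatives of Z(y_k), so
  the curvature turns into a commutator minus the bracket.\<close>

lemma dual_curvature_chart:
  assumes X: "vector_field M U X" and Y: "vector_field M U Y" and Z: "vector_field M U Z"
    and U: "U \<subseteq> fst c" and p: "p \<in> U"
  shows "D' X (D' Y Z) p f - D' Y (D' X Z) p f - D' (bracket M X Y) Z p f = 0"
proof -
  note vf = connection_vector_field[OF conn_D']
  note T = vector_field_tangent
  have o: "openin (mtop M) U" using vector_field_open[OF X] .
  have pc: "p \<in> fst c" using p U by blast
  have second: "D' X (D' Y Z) p (dual_coord k) = X p (\<lambda>q. Y q (\<lambda>r. Z r (dual_coord k)))"
    if X: "vector_field M U X" and Y: "vector_field M U Y" for X Y k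
  proof -
    have "D' X (D' Y Z) p (dual_coord k) = X p (\<lambda>q. D' Y Z q (dual_coord k))"
      by (rule dual_connection_dual_coord[OF X vf[OF Y Z] U p])
    also have "\<dots> = X p (\<lambda>q. Y q (\<lambda>r. Z r (dual_coord k)))"
      by (rule tangent_cong[OF T[OF X p] o p]) (rule dual_connection_dual_coord[OF Y Z U])
    finally show ?thesis .
  qed
  have third: "D' (bracket M X Y) Z p (dual_coord k) =
      X p (\<lambda>q. Y q (\<lambda>r. Z r (dual_coord k))) - Y p (\<lambda>q. X q (\<lambda>r. Z r (dual_coord k)))" for k
  proof -
    have "smooth_fun M (U \<inter> fst c) (\<lambda>r. Z r (dual_coord k))"
      by (rule vector_field_smooth[OF Z dual_coord_smooth])
    \<comment> \<open>\<open>bracket\<close> is the commutator only on functions smooth near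
      \<open>p\<close>; elsewhere it has the default value 0.\<close>
    then have "smooth_near M p (\<lambda>r. Z r (dual_coord k))"
      by (rule smooth_nearI) (use p pc in blast)
    then show ?thesis
      using dual_connection_dual_coord[OF bracket_vector_field[OF X Y] Z U p, of k]
      by (simp add: bracket_def)
  qed
  let ?A = "D' X (D' Y Z) p" and ?B = "D' Y (D' X Z) p" and ?C = "D' (bracket M X Y) Z p"
  have t: "?A \<in> tangent_space M p" "?B \<in> tangent_space M p" "?C \<in> tangent_space M p"
    by (intro T[OF _ p] vf X Y Z bracket_vector_field)+
  have "?A = (\<lambda>f. 1 * ?B f + 1 * ?C f)"
    by (rule dual_coord_eqI[OF pc t(1) tangent_lincomb[OF t(2,3)]])
      (simp add: second[OF X Y] second[OF Y X] third)
  from fun_cong[OF this, of f] show ?thesis by simp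
qed

lemma dual_potential_chart:
  assumes p: "p \<in> fst c"
  obtains d \<psi> where "affine_chart M D' d" "p \<in> fst d" "smooth_fun M (fst d) \<psi>"
    "\<forall>q\<in>fst d. \<forall>i j. g q (coord_field M d i q) (coord_field M d j q) =
           coord_field M d i q (\<lambda>r. coord_field M d j r \<psi>)"
proof -
  have "(\<chi> i j. coord_field M c j p (dual_coord i)) = transpose (gram c p)"
    using metric_coord_coord[OF p] by (simp add: vec_eq_iff transpose_def gram_def)
  then have det: "det (\<chi> i j. coord_field M c j p (dual_coord i)) \<noteq> 0"
    using gram_det_pos[OF chart p] by simp
  obtain d where d: "d \<in> atlas M" "p \<in> fst d" "fst d \<subseteq> fst c" "\<And>k. coord d k = dual_coord k"
    using chart_from_functions[OF chart p dual_coord_smooth det] by metis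
  have od: "openin (mtop M) (fst d)" by (rule chart_open[OF d(1)])
  note vf = vector_field_coord[OF d(1)]
  have delta: "coord_field M d i q (dual_coord j) = (if i = j then 1 else 0)" if "q \<in> fst d" for i j q
    using coord_field_coord[OF d(1) that] d(4) by metis
  have aff: "affine_chart M D' d"
    unfolding affine_chart_def
  proof (intro conjI ballI allI d(1))
    fix q i j assume q: "q \<in> fst d"
    \<comment> \<open>In the new chart the components of a coordinate field are constant, so the
      iterated derivative differentiates a constant.\<close>
    have "D' (coord_field M d i) (coord_field M d j) q (coord d k) = 0" for k
    proof -
      have "D' (coord_field M d i) (coord_field M d j) q (coord d k)
          = coord_field M d i q (\<lambda>r. coord_field M d j r (dual_coord k))"
        unfolding d(4) by (rule dual_connection_dual_coord[OF vf vf d(3) q])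
      also have "\<dots> = coord_field M d i q (\<lambda>r. if j = k then 1 else 0)"
        by (rule tangent_cong[OF coord_field_tangent[OF d(1) q] od q]) (rule delta)
      also have "\<dots> = 0" by (rule tangent_const[OF coord_field_tangent[OF d(1) q]])
      finally show ?thesis .
    qed
    then show "D' (coord_field M d i) (coord_field M d j) q = (\<lambda>_. 0)"
      by (intro tangent_eqI[OF _ tangent_zero[OF topspace_chart[OF d(1) q]] d(1) q]
          vector_field_tangent[OF connection_vector_field[OF conn_D' vf vf] q])
  qed
  \<comment> \<open>the Legendre transform of \<open>\<phi>\<close>\<close>
  define \<psi> where "\<psi> q = (\<Sum>k\<in>UNIV. coord c k q * dual_coord k q) - \<phi> q" for q
  have \<phi>: "smooth_fun M (fst c) \<phi>" using pot unfolding potential_def by blast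
  have xy: "smooth_fun M (fst c) (\<lambda>q. coord c k q * dual_coord k q)" for k
    by (rule smooth_fun_mult[OF smooth_fun_coord[OF chart] dual_coord_smooth])
  have s\<psi>: "smooth_fun M (fst c) \<psi>"
    unfolding \<psi>_def by (intro smooth_fun_diff smooth_fun_sum xy \<phi> chart_open[OF chart])
  \<comment> \<open>The differential of the Legendre transform is the sum of x_k dy_k: the terms y_k
    dx_k from the product rule cancel against the differential of \<open>\<phi>\<close>. So its j-th
    derivative in the new coordinates is x_j.\<close>
  have d\<psi>: "v \<psi> = (\<Sum>k\<in>UNIV. coord c k q * v (dual_coord k))"
    if q: "q \<in> fst c" and v: "v \<in> tangent_space M q" for v q
  proof -
    have nx: "smooth_near M q (coord c k)" and ny: "smooth_near M q (dual_coord k)" for k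
      using smooth_nearI[OF smooth_fun_coord[OF chart] q] smooth_nearI[OF dual_coord_smooth q] by auto
    note nxy = smooth_near_mult[OF nx ny]
    have s: "smooth_near M q (\<lambda>q. \<Sum>k\<in>UNIV. coord c k q * dual_coord k q)"
      "v (\<lambda>q. \<Sum>k\<in>UNIV. coord c k q * dual_coord k q) = (\<Sum>k\<in>UNIV. v (\<lambda>q. coord c k q * dual_coord k q))"
      using tangent_sum_fun[OF v, of UNIV "\<lambda>k q. coord c k q * dual_coord k q"] nxy by auto
    have "v \<psi> = (\<Sum>k\<in>UNIV. v (\<lambda>q. coord c k q * dual_coord k q)) - v \<phi>"
      unfolding \<psi>_def[abs_def] tangent_diff[OF v s(1) smooth_nearI[OF \<phi> q]] s(2) ..
    also have "v \<phi> = (\<Sum>k\<in>UNIV. v (coord c k) * dual_coord k q)"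
      unfolding dual_coord_def by (rule tangent_expand[OF v chart q])
    finally show ?thesis by (simp add: tangent_mult[OF v nx ny] sum.distrib)
  qed
  show ?thesis
  proof (rule that[OF aff d(2)]; (intro ballI allI)?)
    show "smooth_fun M (fst d) \<psi>" by (rule smooth_fun_subset[OF s\<psi> od d(3)])
    fix q i j assume q: "q \<in> fst d"
    then have qc: "q \<in> fst c" using d(3) by blast
    note t = coord_field_tangent[OF d(1) q]
    have "coord_field M d i q (\<lambda>r. coord_field M d j r \<psi>) = coord_field M d i q (coord c j)"
    proof (rule tangent_cong[OF t od q])
      fix r assume r: "r \<in> fst d"
      then have rc: "r \<in> fst c" using d(3) by blast
      show "coord_field M d j r \<psi> = coord c j r"
        by (simp add: d\<psi>[OF rc coord_field_tangent[OF d(1) r]] delta[OF r]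
            if_distrib[of "(*) _"] cong: if_cong)
    qed
    \<comment> \<open>One of the two fields is expanded in the old frame. The other, paired with an
      old coordinate field, yields the derivative of a dual coordinate, which is a Kronecker delta
      in the new chart.\<close>
    moreover have "g q (coord_field M d i q) (coord_field M d j q) = coord_field M d i q (coord c j)"
    proof -
      note tc = coord_field_tangent[OF chart qc]
      have "g q (coord_field M d j q) (coord_field M d i q)
          = g q (coord_field M d j q) (\<lambda>f. \<Sum>k\<in>UNIV. coord_field M d i q (coord c k) * coord_field M c k q f)"
        by (rule arg_cong[where f = "g q _"], rule ext, rule tangent_expand[OF t chart qc])
      also have "\<dots> = (\<Sum>k\<in>UNIV. coord_field M d i q (coord c k) * g q (coord_field M d j q) (coord_field M c k q))"
        by (rule linear_on_tangent_sum[OF metric_linear[OF t] topspace_chart[OF d(1) q]]) (simp_all add: tc)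
      also have "\<dots> = coord_field M d i q (coord c j)"
        by (simp add: metric_coord_right[OF qc t] delta[OF q] if_distrib[of "(*) _"] cong: if_cong)
      finally show ?thesis by (simp add: metric_sym[OF t t, of i j])
    qed
    ultimately show "g q (coord_field M d i q) (coord_field M d j q) =
           coord_field M d i q (\<lambda>r. coord_field M d j r \<psi>)" by simp
  qed
qed

end

text \<open>Restriction only shrinks the open set; the fields stay the same functions. The chart
  version therefore applies on \<open>U \<inter> fst c\<close> as it stands.\<close>

lemma dual_curvature_zero: "curvature_zero M D'"
  unfolding curvature_zero_def
proof (intro allI impI ballI; elim conjE)
  fix U X Y Z p f assume XYZ: "vector_field M U X" "vector_field M U Y" "vector_field M U Z" and p: "p \<in> U"
  have "p \<in> topspace (mtop M)" using p vector_field_open[OF XYZ(1)] openin_subset by blast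
  then obtain c \<phi> where pot: "potential c \<phi>" and pc: "p \<in> fst c" using potential_exists by blast
  have o: "openin (mtop M) (U \<inter> fst c)"
    using vector_field_open[OF XYZ(1)] chart_open[OF chart[OF pot]] by blast
  show "D' X (D' Y Z) p f - D' Y (D' X Z) p f - D' (bracket M X Y) Z p f = 0"
    by (rule dual_curvature_chart[OF pot XYZ[THEN vector_field_subset, OF o Int_lower1]]) (use p pc in auto)
qed

theorem dual_hessian_manifold: "hessian_manifold M D' g"
  unfolding hessian_manifold_def flat_connection_def
proof (intro conjI mfd conn_D' tors_D' dual_curvature_zero metric ballI)
  fix p assume "p \<in> topspace (mtop M)"
  then obtain c \<phi> where "potential c \<phi>" "p \<in> fst c" using potential_exists by blast
  then obtain d \<psi> where "affine_chart M D' d" "p \<in> fst d" "smooth_fun M (fst d) \<psi>"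
    "\<forall>q\<in>fst d. \<forall>i j. g q (coord_field M d i q) (coord_field M d j q) =
           coord_field M d i q (\<lambda>r. coord_field M d j r \<psi>)"
    by (rule dual_potential_chart)
  then show "\<exists>c \<phi>. affine_chart M D' c \<and> p \<in> fst c \<and> smooth_fun M (fst c) \<phi> \<and>
        (\<forall>q\<in>fst c. \<forall>i j. g q (coord_field M c i q) (coord_field M c j q) =
           coord_field M c i q (\<lambda>r. coord_field M c j r \<phi>))" by blast
qed

text \<open>For a metric torsion free connection, (L_X g)(Y, Z) = g(N_Y X, Z) + g(Y, N_Z X), and
  lowering the index commutes with \<open>N\<close>.\<close>

lemma lie_metric_sharp:
  assumes w: "one_form M \<omega>" and Y: "vector_field M U Y" and Z: "vector_field M U Z" and p: "p \<in> U"
  shows "lie_metric M (\<lambda>p f. - 2 * sharp M g \<omega> p f) g Y Z p =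
    - 2 * (cov_one_form N \<omega> Y Z p + cov_one_form N \<omega> Z Y p)"
proof -
  let ?X = "\<lambda>p f. - 2 * sharp M g \<omega> p f"
  have o: "openin (mtop M) U" by (rule vector_field_open[OF Y])
  have top: "U \<subseteq> topspace (mtop M)" using o openin_subset by blast
  have sv: "vector_field M U (sharp M g \<omega>)"
    by (rule vector_field_subset[OF sharp_vector_field[OF w] o top])
  from vector_field_cmult_diff[OF this this, of "-2" 0]
  have X: "vector_field M U ?X" by simp
  note T = vector_field_tangent
  note vf = connection_vector_field[OF conn_N]
  have gX: "g q (?X q) v = - 2 * \<omega> q v" if q: "q \<in> U" and v: "v \<in> tangent_space M q" for q v
  proof -
    have qt: "q \<in> topspace (mtop M)" using top q by blast
    have "linear_on_tangent M q (\<omega> q)" using w qt unfolding one_form_def by blast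
    then have s: "sharp M g \<omega> q \<in> tangent_space M q" "g q (sharp M g \<omega> q) v = \<omega> q v"
      using sharp_tangent_and_eq[of q \<omega>, OF qt] v by auto
    from linear_on_tangent_diff[OF metric_linear_left[OF v] s(1) s(1), of "-2" 0] s(2)
    show ?thesis by simp
  qed
  \<comment> \<open>Metric compatibility gives g(N_Y X, Z) = Y(g(X, Z)) - g(X, N_Y Z), and both
    terms on the right are expressed by \<omega>.\<close>
  have half: "g p (N Y ?X p) (Z p) = - 2 * cov_one_form N \<omega> Y Z p"
    if Y: "vector_field M U Y" and Z: "vector_field M U Z" for Y Z
  proof -
    have "smooth_near M p (\<lambda>q. \<omega> q (Z q))"
      using w Z smooth_nearI[OF _ p] unfolding one_form_def by blast
    then have "Y p (\<lambda>q. - 2 * \<omega> q (Z q)) = - 2 * Y p (\<lambda>q. \<omega> q (Z q))"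
      by (rule tangent_cmult[OF T[OF Y p]])
    moreover have "Y p (\<lambda>q. g q (?X q) (Z q)) = Y p (\<lambda>q. - 2 * \<omega> q (Z q))"
      by (rule tangent_cong[OF T[OF Y p] o p]) (rule gX[OF _ T[OF Z]])
    ultimately show ?thesis
      using levi_civita_metric[OF levi_civita Y X Z p] gX[OF p T[OF vf[OF Y Z] p]]
      by (simp add: cov_one_form_def)
  qed
  have br: "g p (bracket M ?X Y p) v = g p (N ?X Y p) v - g p (N Y ?X p) v"
    if Y: "vector_field M U Y" and v: "v \<in> tangent_space M p" for Y v
    using linear_on_tangent_diff[OF metric_linear_left[OF v] T[OF vf[OF X Y] p] T[OF vf[OF Y X] p], of 1 1]
    unfolding torsion_freeD[OF tors_N X Y p] by (simp only: mult_1)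
  have bt: "bracket M ?X Z p \<in> tangent_space M p" by (rule T[OF bracket_vector_field[OF X Z] p])
  \<comment> \<open>Writing the brackets with \<open>N\<close> and expanding the derivative of g(Y,
    Z) along X, the terms containing N_X Y and N_X Z cancel.\<close>
  have "lie_metric M ?X g Y Z p = g p (N Y ?X p) (Z p) + g p (N Z ?X p) (Y p)"
    unfolding lie_metric_def levi_civita_metric[OF levi_civita X Y Z p] br[OF Y T[OF Z p]]
      metric_sym[OF T[OF Y p] bt] br[OF Z T[OF Y p]] metric_sym[OF T[OF Y p] T[OF vf[OF X Z] p]]
    by simp
  then show ?thesis unfolding half[OF Y Z] half[OF Z Y] by (simp only: distrib_left)
qed

end

theorem corollary5p3:
  fixes M :: "('a, 'n::finite) mfd"
    and D N :: "'a vfield \<Rightarrow> 'a vfield \<Rightarrow> 'a vfield"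
    and g :: "'a \<Rightarrow> 'a tvec \<Rightarrow> 'a tvec \<Rightarrow> real"
    and \<alpha> :: "'a \<Rightarrow> 'a tvec \<Rightarrow> real"
    and lam :: real
  assumes "hesse_einstein M D g lam"
    and "levi_civita M g N"
    and "first_koszul_form M D g \<alpha>"
  shows "hesse_soliton_with M (dual_connection N D) g
           (\<lambda>p f. - 2 * sharp M g \<alpha> p f) lam"
proof -
  have hess: "hessian_manifold M D g" using assms(1) unfolding hesse_einstein_def by blast
  interpret hessian_mfd M g D N
    by unfold_locales (use hess assms(2) in \<open>auto simp: hessian_manifold_def\<close>)
  obtain \<alpha>\<^sub>0 where a0: "first_koszul_form M D g \<alpha>\<^sub>0"
    and ein: "\<And>U Y Z p. vector_field M U Y \<Longrightarrow> vector_field M U Z \<Longrightarrow> p \<in> U \<Longrightarrow>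
      cov_one_form D \<alpha>\<^sub>0 Y Z p = lam * g p (Y p) (Z p)"
    using assms(1) unfolding hesse_einstein_def by blast
  have one: "one_form M \<alpha>" using assms(3) unfolding first_koszul_form_def by blast
  note unique = first_koszul_form_unique[OF assms(3) a0]
  show ?thesis
    unfolding hesse_soliton_with_def
  proof (intro conjI dual_hessian_manifold exI allI impI ballI)
    note sv = sharp_vector_field[OF one]
    from vector_field_cmult_diff[OF sv sv, of "-2" 0]
    show "vector_field M (topspace (mtop M)) (\<lambda>p f. - 2 * sharp M g \<alpha> p f)" by simp
    show "first_koszul_form M D' g (\<lambda>p v. - \<alpha> p v)"
      by (rule first_koszul_form_dual[OF assms(2,3)])
    fix U Y Z p assume "vector_field M U Y \<and> vector_field M U Z" and p: "p \<in> U"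
    then have Y: "vector_field M U Y" and Z: "vector_field M U Z" by auto
    note T = vector_field_tangent
    have o: "openin (mtop M) U" by (rule vector_field_open[OF Y])
    have lin: "linear_on_tangent M p (\<alpha> p)"
      using one tangent_in_topspace[OF T[OF Y p]] unfolding one_form_def by blast
    have Nt: "N Y Z p \<in> tangent_space M p" "N Z Y p \<in> tangent_space M p"
      and Dt: "D Y Z p \<in> tangent_space M p" "D Z Y p \<in> tangent_space M p"
      by (intro T[OF _ p] connection_vector_field[OF conn_N] connection_vector_field[OF conn_D] Y Z)+
    \<comment> \<open>Both sides are \<alpha> of the bracket of \<open>Y\<close> and
      \<open>Z\<close>.\<close>
    have tors: "\<alpha> p (N Y Z p) - \<alpha> p (N Z Y p) = \<alpha> p (D Y Z p) - \<alpha> p (D Z Y p)"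
      using linear_on_tangent_diff[OF lin Nt, of 1 1] linear_on_tangent_diff[OF lin Dt, of 1 1]
        torsion_freeD[OF tors_N Y Z p] torsion_freeD[OF tors_D Y Z p] by simp
    \<comment> \<open>The soliton expression will reduce to the second Koszul form with its
      arguments exchanged, hence \<open>Z\<close> before \<open>Y\<close>; symmetry of
      \<open>g\<close> restores the order afterwards. The two Koszul forms agree pointwise, so by
      locality their derivatives agree.\<close>
    have "cov_one_form D \<alpha> Z Y p = cov_one_form D \<alpha>\<^sub>0 Z Y p"
    proof -
      have "Z p (\<lambda>q. \<alpha> q (Y q)) = Z p (\<lambda>q. \<alpha>\<^sub>0 q (Y q))"
        by (rule tangent_cong[OF T[OF Z p] o p]) (rule unique[OF T[OF Y]])
      then show ?thesis unfolding cov_one_form_def using unique[OF Dt(2)] by simp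
    qed
    then have einstein: "cov_one_form D \<alpha> Z Y p = lam * g p (Y p) (Z p)"
      using ein[OF Z Y p] metric_sym[OF T[OF Y p] T[OF Z p]] by simp
    have "smooth_near M p (\<lambda>q. \<alpha> q (Z q))"
      using one Z smooth_nearI[OF _ p] unfolding one_form_def by blast
    from tangent_cmult[OF T[OF Y p] this, of "-1"]
    have "cov_one_form D' (\<lambda>p v. - \<alpha> p v) Y Z p
        = - Y p (\<lambda>q. \<alpha> q (Z q)) + 2 * \<alpha> p (N Y Z p) - \<alpha> p (D Y Z p)"
      using linear_on_tangent_diff[OF lin Nt(1) Dt(1), of 2 1]
      by (simp add: cov_one_form_def dual_connection_def)
    then show "cov_one_form D' (\<lambda>p v. - \<alpha> p v) Y Z p
        - 1/2 * lie_metric M (\<lambda>p f. - 2 * sharp M g \<alpha> p f) g Y Z p = lam * g p (Y p) (Z p)"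
      using tors einstein unfolding lie_metric_sharp[OF one Y Z p] cov_one_form_def by argo
  qed
qed

end
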